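(* Assume that the environment $\omega$ has non-increasing correlations. Then $$h_c(\beta)=-\beta\ \text{ for all }\beta>0\quad\Longleftrightarrow\quad\liminf_{n\to\infty}-\frac1n\log\mathbb P(\omega_1=+1,\ldots,\omega_n=+1)=0 .$$ Moreover, if $\liminf_{n\to\infty}-\frac1n\log\mathbb P(\omega_1=+1,\ldots,\omega_n=+1)>0$, then $h_c(\beta)>-\beta$ for all $\beta>0$.
   Context: Renewal process: $\tau=(\tau_i)_{i\ge 0}$ has law $\mathbf P$ (expectation $\mathbf E$), $\tau_0=0$, and the increments $(\tau_i-\tau_{i-1})_{i\ge1}$ are i.i.d. with values in $\mathbb N=\{1,2,\ldots\}$ and law $K(n):=\mathbf P(\tau_1=n)$. The renewal is recurrent, $\mathbf P(\tau_1=+\infty)=0$, and $K(n)=(1+o(1))\,c_K n^{-(1+\alpha)}$ as $n\to\infty$ for some $\alpha>0$, $\alpha\neq1$, and $c_K>0$. Set $\delta_n:=\mathbf 1_{\{n\in\{\tau_0,\tau_1,\ldots\}\}}$. Environment: $\omega=(\omega_i)_{i\ge0}$ is a stationary ergodic random sequence with values in $\{-1,+1\}$, with law $\mathbb P$ (independent of $\tau$), non-trivial in the sense that $\mathbb P(\omega_1=+1)>0$ and $\mathbb P(\omega_1=-1)>0$. Pinning model: for $h\in\mathbb R$, $\beta\ge0$, $Z_{N,h}^{\omega,\beta}:=\mathbf E\big[\exp\big(\sum_{n=1}^N(h+\beta\omega_n)\delta_n\big)\big]$. The quenched free energy $\mathtt F(\beta,h):=\lim_{N\to\infty}\frac1N\log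 Z_{N,h}^{\omega,\beta}$ exists and is $\mathbb P$-a.s. constant; $h\mapsto\mathtt F(\beta,h)$ is convex, non-negative and non-decreasing. The quenched critical point $h_c(\beta)$ is such that $\mathtt F(\beta,h)>0$ if and only if $h>h_c(\beta)$. Non-increasing correlations: for a finite set of indices $\mathcal E=\{i_1,\ldots,i_n\}\subset\mathbb N$ let $\mathfrak F_{\mathcal E}:=\{\omega_{i_1}=+1,\ldots,\omega_{i_n}=+1\}$ and $\theta^l\mathcal E:=\{i+l:\ i\in\mathcal E\}$. Correlations are non-increasing if for every two finite sets of indices $\mathcal E_1,\mathcal E_2$ with $\max\mathcal E_1<\min\mathcal E_2$ one has $\mathbb P(\mathfrak F_{\mathcal E_1\cup\theta^{k+1}\mathcal E_2})\le\mathbb P(\mathfrak F_{\mathcal E_1\cup\theta^{k}\mathcal E_2})$ for all $k\ge0$. *)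

theory Defs
  imports "HOL-Probability.Probability"
begin

text \<open>
  A recurrent renewal process on \<open>{1, 2, \<dots>}\<close>. Recurrence, i.e. that \<open>\<tau> 1\<close> is almost surely
  finite, is built into the type of \<open>\<tau>\<close>: the increments take no infinite value. The truncated
  subtraction is harmless since \<open>\<tau>\<close> is strictly increasing.
\<close>

locale renewal_process = prob_space M for M :: "'a measure" +
  fixes \<tau> :: "nat \<Rightarrow> 'a \<Rightarrow> nat"
  assumes measurable_renewal: "\<And>i. random_variable (count_space UNIV) (\<tau> i)"
    and renewal_0: "\<And>x. x \<in> space M \<Longrightarrow> \<tau> 0 x = 0"
    and renewal_less: "\<And>i x. x \<in> space M \<Longrightarrow> \<tau> i x < \<tau> (Suc i) x"
    and indep_increments:
      "indep_vars (\<lambda>_. count_space UNIV) (\<lambda>i x. \<tau> (Suc i) x - \<tau> i x) UNIV"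
    and distr_increments:
      "\<And>i. distr M (count_space UNIV) (\<lambda>x. \<tau> (Suc i) x - \<tau> i x)
            = distr M (count_space UNIV) (\<tau> 1)"

definition inter_arrival :: "'a measure \<Rightarrow> (nat \<Rightarrow> 'a \<Rightarrow> nat) \<Rightarrow> nat \<Rightarrow> real" where
  "inter_arrival M \<tau> n = measure M {x \<in> space M. \<tau> 1 x = n}"

definition contact :: "(nat \<Rightarrow> 'a \<Rightarrow> nat) \<Rightarrow> nat \<Rightarrow> 'a \<Rightarrow> real" where
  "contact \<tau> n x = of_bool (n \<in> range (\<lambda>i. \<tau> i x))"

abbreviation sequence_space :: "(nat \<Rightarrow> real) measure" where
  "sequence_space \<equiv> PiM UNIV (\<lambda>_. borel)"

definition seq_shift :: "(nat \<Rightarrow> real) \<Rightarrow> nat \<Rightarrow> real" where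
  "seq_shift w = (\<lambda>i. w (Suc i))"

definition stationary_law :: "(nat \<Rightarrow> real) measure \<Rightarrow> bool" where
  "stationary_law L \<longleftrightarrow> distr L sequence_space seq_shift = L"

definition ergodic_law :: "(nat \<Rightarrow> real) measure \<Rightarrow> bool" where
  "ergodic_law L \<longleftrightarrow>
     (\<forall>A \<in> sets sequence_space. seq_shift -` A = A \<longrightarrow> measure L A = 0 \<or> measure L A = 1)"

text \<open>
  The environment lives on a probability space of its own, so that it is independent of the
  renewal process; stationarity and ergodicity are properties of its law on sequence space.
\<close>

locale sign_environment = prob_space P for P :: "'b measure" +
  fixes \<omega> :: "nat \<Rightarrow> 'b \<Rightarrow> real"
  assumes measurable_env: "\<And>i. random_variable borel (\<omega> i)"
    and env_values: "\<And>i y. y \<in> space P \<Longrightarrow> \<omega> i y \<in> {-1, 1}"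
    and stationary_env: "stationary_law (distr P sequence_space (\<lambda>y i. \<omega> i y))"
    and ergodic_env: "ergodic_law (distr P sequence_space (\<lambda>y i. \<omega> i y))"
    and env_plus: "prob {y \<in> space P. \<omega> 1 y = 1} > 0"
    and env_minus: "prob {y \<in> space P. \<omega> 1 y = -1} > 0"

definition all_plus :: "'b measure \<Rightarrow> (nat \<Rightarrow> 'b \<Rightarrow> real) \<Rightarrow> nat set \<Rightarrow> 'b set" where
  "all_plus P \<omega> E = {y \<in> space P. \<forall>i\<in>E. \<omega> i y = 1}"

text \<open>
  Index sets are nonempty so that \<open>Max\<close> and \<open>Min\<close> are meaningful.
\<close>

definition nonincreasing_correlations :: "'b measure \<Rightarrow> (nat \<Rightarrow> 'b \<Rightarrow> real) \<Rightarrow> bool" where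
  "nonincreasing_correlations P \<omega> \<longleftrightarrow>
     (\<forall>E1 E2. finite E1 \<and> finite E2 \<and> E1 \<noteq> {} \<and> E2 \<noteq> {} \<and> E1 \<subseteq> {1..} \<and> E2 \<subseteq> {1..} \<and>
        Max E1 < Min E2 \<longrightarrow>
        (\<forall>k. measure P (all_plus P \<omega> (E1 \<union> (\<lambda>i. i + (k + 1)) ` E2))
             \<le> measure P (all_plus P \<omega> (E1 \<union> (\<lambda>i. i + k) ` E2))))"

definition partition_function ::
  "'a measure \<Rightarrow> (nat \<Rightarrow> 'a \<Rightarrow> nat) \<Rightarrow> real \<Rightarrow> real \<Rightarrow> (nat \<Rightarrow> real) \<Rightarrow> nat \<Rightarrow> real" where
  "partition_function M \<tau> \<beta> h w N =
     (LINT x|M. exp (\<Sum>n=1..N. (h + \<beta> * w n) * contact \<tau> n x))"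

text \<open>
  The almost sure (nonrandom) limit of \<open>1/N log Z\<close>.
\<close>

definition free_energy ::
  "'a measure \<Rightarrow> (nat \<Rightarrow> 'a \<Rightarrow> nat) \<Rightarrow> 'b measure \<Rightarrow> (nat \<Rightarrow> 'b \<Rightarrow> real) \<Rightarrow> real \<Rightarrow> real \<Rightarrow> real"
  where
  "free_energy M \<tau> P \<omega> \<beta> h =
     (THE f. AE y in P.
        (\<lambda>N. 1 / real N * ln (partition_function M \<tau> \<beta> h (\<lambda>i. \<omega> i y) N)) \<longlonglongrightarrow> f)"

definition critical_point ::
  "'a measure \<Rightarrow> (nat \<Rightarrow> 'a \<Rightarrow> nat) \<Rightarrow> 'b measure \<Rightarrow> (nat \<Rightarrow> 'b \<Rightarrow> real) \<Rightarrow> real \<Rightarrow> real" where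
  "critical_point M \<tau> P \<omega> \<beta> = (THE c. \<forall>h. free_energy M \<tau> P \<omega> \<beta> h > 0 \<longleftrightarrow> h > c)"

text \<open>
  Logarithm of a probability, with \<open>log 0 = -\<infinity>\<close>; the library's real \<open>ln\<close> has \<open>ln 0 = 0\<close>,
  which would give the wrong rate for environments in which long \<open>+1\<close> stretches are impossible.
\<close>

definition log_prob :: "real \<Rightarrow> ereal" where
  "log_prob p = (if p = 0 then -\<infinity> else ereal (ln p))"

definition plus_stretch_rate :: "'b measure \<Rightarrow> (nat \<Rightarrow> 'b \<Rightarrow> real) \<Rightarrow> ereal" where
  "plus_stretch_rate P \<omega> =
     liminf (\<lambda>n. ereal (- (1 / real n)) * log_prob (measure P (all_plus P \<omega> {1..n})))"

end

theory Submission
  imports Defs "HOL-Real_Asymp.Real_Asymp"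
begin

text \<open>
  Since a contact collects at most \<open>h + \<beta>\<close>, the partition function at \<open>h \<le> - \<beta>\<close> is at most 1, and keeping
  a single long excursion shows that it decays only polynomially; hence the free energy is
  nonnegative everywhere and vanishes up to \<open>- \<beta>\<close>. It is nondecreasing and 1-Lipschitz in \<open>h\<close>, so the
  critical point is the infimum of the fields with positive free energy, and the theorem asks
  whether this infimum is \<open>- \<beta>\<close>.

  \<^item> \<^emph>\<open>Zero rate.\<close> Fix \<open>h > - \<beta>\<close>. On a stretch of \<open>l\<close> positive charges the pinned partition function
    is that of a homogeneous model with reward \<open>h + \<beta> > 0\<close>, which is at least of order \<open>exp (R l)\<close> with
    \<open>R > 0\<close>. Such stretches have frequency \<open>q\<close>, and \<open>q \<ge> exp (- \<epsilon> l)\<close> for infinitely many \<open>l\<close>. A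
    trajectory that jumps from stretch to stretch pays a power of the jump length, of order
    \<open>1 / q\<close>, that is a factor not much smaller than \<open>exp (- (1 + \<alpha>) \<epsilon> l)\<close>. For small \<open>\<epsilon>\<close> the gain
    wins, and the free energy is positive (\<open>free_energy_pos_of_subexponential\<close>, built on
    \<open>pinned_lower_bound_by_good_stretches\<close>).

  \<^item> \<^emph>\<open>Positive rate.\<close> Non-increasing correlations make it most likely for a set of given size to be
    all plus when it is an interval (\<open>prob_all_plus_le_block\<close>), so any \<open>n\<close> sites are all plus with
    probability at most \<open>C s^n\<close> with \<open>s < 1\<close>. Expanding the Boltzmann factor of each contact into a
    constant and a multiple of the indicator of a plus, the annealed weight of \<open>n\<close> contacts is at
    most \<open>C (exp (h + \<beta>) q)^n\<close> for some \<open>q < 1\<close> that depends only on \<open>\<beta>\<close> and \<open>s\<close>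
    (\<open>expectation_boltzmann_le\<close>). At \<open>h = - \<beta> - ln q > - \<beta>\<close> the annealed partition function stays
    bounded and the free energy vanishes (\<open>free_energy_zero_of_decay\<close>).

  The free energy and the critical point are definite descriptions, so both arguments rely on the
  existence of the almost sure limit. The logarithm of the partition function pinned at its
  endpoint is superadditive along the shift, and the free partition function differs from it by a
  power of \<open>N\<close>; the limit is therefore an instance of the superadditive ergodic theorem, which is
  proved below for linearly bounded sequences (\<open>superadditive_ergodic\<close>).
\<close>

section \<open>Superadditive sequences over an ergodic map\<close>

locale ergodic_map = prob_space M for M :: "'c measure" +
  fixes T :: "'c \<Rightarrow> 'c"
  assumes map_measurable [measurable]: "T \<in> measurable M M"
    and map_preserves: "distr M M T = M"
    and map_ergodic: "\<And>A. A \<in> sets M \<Longrightarrow> T -` A \<inter> space M = A \<Longrightarrow> prob A = 0 \<or> prob A = 1"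
begin

lemma iterate_measurable [measurable]: "(T ^^ k) \<in> measurable M M"
  by (induction k) auto

lemma iterate_space: "w \<in> space M \<Longrightarrow> (T ^^ k) w \<in> space M"
  using iterate_measurable[of k] by (rule measurable_space)

lemma distr_iterate: "distr M M (T ^^ k) = M"
proof (induction k)
  case 0
  then show ?case by (simp add: id_def distr_id)
next
  case (Suc k)
  have "distr M M (T ^^ Suc k) = distr (distr M M (T ^^ k)) M T"
    by (subst distr_distr) (auto simp: comp_def)
  also have "\<dots> = M" using Suc map_preserves by simp
  finally show ?case .
qed

lemma prob_iterate:
  assumes "A \<in> sets M"
  shows "prob ((T ^^ k) -` A \<inter> space M) = prob A"
  using measure_distr[OF iterate_measurable assms] by (simp add: distr_iterate)

text \<open>
  The points with infinitely many visits to \<open>A\<close> form a strictly invariant set, so ergodicity gives it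
  probability 0 or 1. It is at least as likely as \<open>A\<close>: it is the decreasing limit of the events that a
  visit occurs after time \<open>n\<close>, and each of them contains a preimage of \<open>A\<close>.
\<close>

lemma visits_infinitely_often:
  assumes A [measurable]: "A \<in> sets M" and pos: "prob A > 0"
  shows "AE w in M. \<exists>\<^sub>F k in sequentially. (T ^^ k) w \<in> A"
proof -
  define C where "C n = (\<Union>k\<in>{n..}. (T ^^ k) -` A \<inter> space M)" for n
  define B where "B = (\<Inter>n. C n)"
  have C_meas [measurable]: "C n \<in> sets M" for n
    unfolding C_def by measurable
  have B_iff: "w \<in> B \<longleftrightarrow> w \<in> space M \<and> (\<exists>\<^sub>F k in sequentially. (T ^^ k) w \<in> A)" for w
    unfolding B_def C_def frequently_sequentially by auto
  have B_meas: "B \<in> sets M"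
    unfolding B_def by measurable
  have shift: "(\<exists>\<^sub>F k in sequentially. (T ^^ k) (T w) \<in> A) \<longleftrightarrow> (\<exists>\<^sub>F k in sequentially. (T ^^ k) w \<in> A)" for w
    using eventually_sequentially_Suc[of "\<lambda>k. (T ^^ k) w \<notin> A"]
    by (simp add: frequently_def funpow_swap1)
  have "T -` B \<inter> space M = B"
    using measurable_space[OF map_measurable] by (auto simp: B_iff shift)
  then have "prob B = 0 \<or> prob B = 1"
    using map_ergodic B_meas by blast
  moreover have "prob A \<le> prob B"
  proof (rule LIMSEQ_le_const)
    show "(\<lambda>n. prob (C n)) \<longlonglongrightarrow> prob B"
      unfolding B_def
      by (rule finite_Lim_measure_decseq) (use C_meas in \<open>auto simp: decseq_def C_def intro: order_trans\<close>)
    have "prob A \<le> prob (C n)" for n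
    proof -
      have "prob A = prob ((T ^^ n) -` A \<inter> space M)"
        by (simp add: prob_iterate)
      also have "\<dots> \<le> prob (C n)"
        by (rule finite_measure_mono) (auto simp: C_def)
      finally show ?thesis .
    qed
    then show "\<exists>N. \<forall>n\<ge>N. prob A \<le> prob (C n)" by blast
  qed
  ultimately have "prob B = 1" using pos by linarith
  then have "AE w in M. w \<in> B"
    by (simp add: AE_in_set_eq_1 B_meas)
  then show ?thesis
    by (rule AE_mp) (auto simp: B_iff)
qed

text \<open>
  The threshold is there because a pinned partition function may vanish at short lengths, where its
  logarithm carries no information.
\<close>

definition superadditive_from :: "nat \<Rightarrow> (nat \<Rightarrow> 'c \<Rightarrow> real) \<Rightarrow> bool" where
  "superadditive_from n0 X \<longleftrightarrow>
     (\<forall>n\<ge>n0. \<forall>m\<ge>n0. \<forall>w\<in>space M. X n w + X m ((T ^^ n) w) \<le> X (n + m) w)"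

lemma superadditive_fromD:
  "superadditive_from n0 X \<Longrightarrow> n0 \<le> n \<Longrightarrow> n0 \<le> m \<Longrightarrow> w \<in> space M
    \<Longrightarrow> X n w + X m ((T ^^ n) w) \<le> X (n + m) w"
  by (simp add: superadditive_from_def)

text \<open>
  Superadditivity carries a growth rate from any later point of an orbit back to its start: the
  initial segment contributes a nonnegative amount and only a bounded length. Almost every orbit
  visits the set of points with upper rate above \<open>c\<close>, so it has itself an upper rate above any
  \<open>c' < c\<close>. This plays the part of shift invariance of the upper rate.
\<close>

lemma upper_rate_almost_surely:
  assumes meas [measurable]: "\<And>n. X n \<in> borel_measurable M"
    and nonneg: "\<And>n w. n0 \<le> n \<Longrightarrow> w \<in> space M \<Longrightarrow> 0 \<le> X n w"
    and super: "superadditive_from n0 X"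
    and "c' < c" and pos: "prob {w \<in> space M. \<exists>\<^sub>F n in sequentially. c * real n < X n w} > 0"
  shows "AE w in M. \<exists>\<^sub>F n in sequentially. c' * real n < X n w"
proof -
  define A where "A = {w \<in> space M. \<exists>\<^sub>F n in sequentially. c * real n < X n w}"
  have A_meas: "A \<in> sets M" unfolding A_def frequently_sequentially by measurable
  have "AE w in M. \<exists>\<^sub>F k in sequentially. (T ^^ k) w \<in> A"
    using visits_infinitely_often[OF A_meas] pos by (simp add: A_def)
  then show ?thesis
  proof (rule AE_mp, intro AE_I2 impI)
    fix w assume w: "w \<in> space M" and "\<exists>\<^sub>F k in sequentially. (T ^^ k) w \<in> A"
    then obtain k where k: "k \<ge> n0" "(T ^^ k) w \<in> A"
      unfolding frequently_sequentially by blast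
    show "\<exists>\<^sub>F n in sequentially. c' * real n < X n w"
      unfolding frequently_sequentially
    proof
      fix m
      obtain r where r: "real r \<ge> c' * real k / (c - c')" by (meson real_arch_simple)
      obtain n where n: "n \<ge> Max {m, n0, r}" "c * real n < X n ((T ^^ k) w)"
        using k(2) unfolding A_def frequently_sequentially by blast
      then have n': "n \<ge> m" "n \<ge> n0" "n \<ge> r" by auto
      have "c' * real k \<le> (c - c') * real r"
        using r \<open>c' < c\<close> by (simp add: field_simps)
      also have "\<dots> \<le> (c - c') * real n" using n' \<open>c' < c\<close> by (simp add: mult_left_mono)
      finally have "c' * real (k + n) \<le> c * real n" by (simp add: algebra_simps)
      also have "\<dots> < X n ((T ^^ k) w)" by fact
      also have "\<dots> \<le> X (k + n) w"
        using superadditive_fromD[OF super k(1) n'(2) w] nonneg[OF k(1) w] by linarith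
      finally show "\<exists>n\<ge>m. c' * real n < X n w" using n'(1) by (intro exI[of _ "k + n"]) auto
    qed
  qed
qed

lemma sum_iterate_add:
  "(\<Sum>k<n + m. g ((T ^^ k) w)) = (\<Sum>k<n. g ((T ^^ k) w)) + (\<Sum>k<m. (g ((T ^^ k) ((T ^^ n) w)) :: real))"
  by (induction m) (simp_all add: funpow_add add.commute)

text \<open>
  Greedy tiling of an orbit segment of length \<open>N\<close>. Outside \<open>B\<close> a tile of length at most \<open>L\<close> with gain
  rate \<open>a\<close> is available, and at a point of \<open>B\<close> the tile has length \<open>n0\<close> and gains nothing. The only
  losses are the tiles started in \<open>B\<close> and the last part of the segment, where a tile might not fit.
\<close>

lemma tiling_lower_bound:
  assumes nonneg: "\<And>n w. n0 \<le> n \<Longrightarrow> w \<in> space M \<Longrightarrow> 0 \<le> X n w"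
    and super: "superadditive_from n0 X"
    and "1 \<le> n0" and "0 \<le> a"
    and good: "\<forall>w\<in>space M - B. \<exists>j. n0 \<le> j \<and> j \<le> L \<and> a * real j \<le> X j w"
    and "w \<in> space M" and "n0 \<le> N"
  shows "a * (real N - real L - 2 * real n0 - real n0 * (\<Sum>k<N. indicator B ((T ^^ k) w))) \<le> X N w"
  using \<open>w \<in> space M\<close> \<open>n0 \<le> N\<close>
proof (induction N arbitrary: w rule: less_induct)
  case (less N w)
  have cnt: "0 \<le> (\<Sum>k<n. indicator B ((T ^^ k) v) :: real)" for n v
    by (simp add: sum_nonneg)
  show ?case
  proof (cases "N < L + 2 * n0")
    case True
    have "real N - real L - 2 * real n0 - real n0 * (\<Sum>k<N. indicator B ((T ^^ k) w)) \<le> 0"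
      using True mult_nonneg_nonneg[OF of_nat_0_le_iff[of n0] cnt[of w N]] by linarith
    then have "a * (real N - real L - 2 * real n0 - real n0 * (\<Sum>k<N. indicator B ((T ^^ k) w))) \<le> 0"
      using \<open>0 \<le> a\<close> by (simp add: mult_nonneg_nonpos)
    then show ?thesis using nonneg[OF less.prems(2) less.prems(1)] by linarith
  next
    case False
    \<comment> \<open>From a point of \<open>B\<close> jump by \<open>n0\<close> and gain nothing; the visit to \<open>B\<close> pays for the loss.\<close>
    define j where "j = (if w \<in> B then n0 else (SOME j. n0 \<le> j \<and> j \<le> L \<and> a * real j \<le> X j w))"
    have j: "n0 \<le> j" "j + n0 \<le> N" and gain: "a * (real j - real n0 * indicator B w) \<le> X j w"
    proof -
      have "n0 \<le> j \<and> j + n0 \<le> N \<and> a * (real j - real n0 * indicator B w) \<le> X j w"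
      proof (cases "w \<in> B")
        case True
        then show ?thesis using False nonneg[of n0 w] less.prems by (auto simp: j_def)
      next
        case False2: False
        have "n0 \<le> j \<and> j \<le> L \<and> a * real j \<le> X j w"
          using someI_ex[OF bspec[OF good DiffI[OF less.prems(1) False2]]] False2 by (simp add: j_def)
        then show ?thesis using False False2 by auto
      qed
      then show "n0 \<le> j" "j + n0 \<le> N" "a * (real j - real n0 * indicator B w) \<le> X j w" by auto
    qed
    have split: "(\<Sum>k<N. indicator B ((T ^^ k) w)) =
        (\<Sum>k<j. indicator B ((T ^^ k) w)) + (\<Sum>k<N - j. indicator B ((T ^^ k) ((T ^^ j) w)) :: real)"
      using sum_iterate_add[of "indicator B" w j "N - j"] j by simp
    have first: "indicator B w \<le> (\<Sum>k<j. indicator B ((T ^^ k) w) :: real)"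
      using member_le_sum[of 0 "{..<j}" "\<lambda>k. indicator B ((T ^^ k) w) :: real"] j \<open>1 \<le> n0\<close> by simp
    have IH: "a * (real (N - j) - real L - 2 * real n0
        - real n0 * (\<Sum>k<N - j. indicator B ((T ^^ k) ((T ^^ j) w)))) \<le> X (N - j) ((T ^^ j) w)"
      using less.IH[of "N - j" "(T ^^ j) w"] j \<open>1 \<le> n0\<close> iterate_space[OF less.prems(1)] by simp
    have "a * (real N - real L - 2 * real n0 - real n0 * (\<Sum>k<N. indicator B ((T ^^ k) w)))
        \<le> a * (real j - real n0 * indicator B w) + a * (real (N - j) - real L - 2 * real n0
        - real n0 * (\<Sum>k<N - j. indicator B ((T ^^ k) ((T ^^ j) w))))"
      unfolding split distrib_left[symmetric]
      using j first \<open>0 \<le> a\<close> mult_left_mono[OF first of_nat_0_le_iff[of n0]]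
      by (intro mult_left_mono) (auto simp: algebra_simps)
    also have "\<dots> \<le> X j w + X (N - j) ((T ^^ j) w)" using gain IH by (rule add_mono)
    also have "\<dots> \<le> X N w"
      using superadditive_fromD[OF super j(1) _ less.prems(1), of "N - j"] j by simp
    finally show ?thesis .
  qed
qed


text \<open>
  Almost surely some length at least \<open>n0\<close> realizes the rate \<open>a\<close>; by continuity of measure such a length
  can be bounded by a constant up to an event of small probability.
\<close>

lemma bounded_waiting_time:
  assumes meas [measurable]: "\<And>n. X n \<in> borel_measurable M"
    and freq: "AE w in M. \<exists>\<^sub>F n in sequentially. a * real n < X n w"
    and "0 < \<delta>"
  shows "\<exists>L B. B \<in> sets M \<and> prob B < \<delta> \<and>
    (\<forall>w\<in>space M - B. \<exists>j. n0 \<le> j \<and> j \<le> L \<and> a * real j \<le> X j w)"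
proof -
  define G where "G L = {w \<in> space M. \<exists>j\<in>{n0..L}. a * real j \<le> X j w}" for L
  have G_meas [measurable]: "G L \<in> sets M" for L
    unfolding G_def by measurable
  have "AE w in M. w \<in> (\<Union>L. G L)"
    using freq
  proof (rule AE_mp, intro AE_I2 impI)
    fix w assume "w \<in> space M" "\<exists>\<^sub>F n in sequentially. a * real n < X n w"
    then obtain n where "n \<ge> n0" "a * real n < X n w"
      unfolding frequently_sequentially by blast
    then have "w \<in> G n" using \<open>w \<in> space M\<close> by (auto simp: G_def intro!: bexI[of _ n])
    then show "w \<in> (\<Union>L. G L)" by blast
  qed
  then have "prob (\<Union>L. G L) = 1"
    by (subst AE_in_set_eq_1[symmetric]) auto
  moreover have "(\<lambda>L. prob (G L)) \<longlonglongrightarrow> prob (\<Union>L. G L)"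
    by (rule finite_Lim_measure_incseq) (use G_meas in \<open>auto simp: incseq_def G_def intro: order_trans\<close>)
  ultimately have "\<forall>\<^sub>F L in sequentially. 1 - \<delta> < prob (G L)"
    using \<open>0 < \<delta>\<close> by (intro order_tendstoD(1)) auto
  then obtain L where L: "1 - \<delta> < prob (G L)"
    by (auto simp: eventually_sequentially)
  have "prob (space M - G L) < \<delta>"
    using L by (simp add: prob_compl)
  moreover have "\<forall>w\<in>space M - (space M - G L). \<exists>j. n0 \<le> j \<and> j \<le> L \<and> a * real j \<le> X j w"
    by (auto simp: G_def)
  ultimately show ?thesis
    by (intro exI[of _ L] exI[of _ "space M - G L"]) simp
qed

text \<open>
  The upper half of Birkhoff's theorem for an indicator. An upper frequency above \<open>prob B + e\<close> on an
  event of positive probability would let almost every orbit be tiled at a rate above \<open>prob B\<close>,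
  so that the mean number of visits in \<open>N\<close> steps would exceed its exact value \<open>N * prob B\<close>.
\<close>

lemma visit_frequency_le:
  assumes B [measurable]: "B \<in> sets M" and "0 < e"
  shows "AE w in M. \<forall>\<^sub>F N in sequentially. (\<Sum>k<N. indicator B ((T ^^ k) w)) \<le> (prob B + e) * real N"
proof -
  define X where "X N w = (\<Sum>k<N. indicator B ((T ^^ k) w) :: real)" for N w
  have X_meas [measurable]: "X N \<in> borel_measurable M" for N
    unfolding X_def by measurable
  have nonneg: "0 \<le> X N w" for N w
    by (simp add: X_def sum_nonneg)
  have super: "superadditive_from 1 X"
    unfolding superadditive_from_def X_def by (simp add: sum_iterate_add)
  have integral_ind: "expectation (\<lambda>w. indicator A ((T ^^ k) w)) = prob A" if "A \<in> sets M" for A k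
  proof -
    have "expectation (\<lambda>w. indicator A ((T ^^ k) w) :: real)
        = expectation (indicator ((T ^^ k) -` A \<inter> space M))"
      by (rule Bochner_Integration.integral_cong) (auto simp: indicator_def)
    then show ?thesis using that by (simp add: prob_iterate)
  qed
  have int: "integrable M (\<lambda>w. indicator A ((T ^^ k) w) :: real)" if "A \<in> sets M" for A k
    by (rule integrable_const_bound[of _ 1]) (use that in \<open>auto simp: indicator_def\<close>)
  have E_sum: "expectation (\<lambda>w. \<Sum>k<N. indicator A ((T ^^ k) w)) = real N * prob A"
    if "A \<in> sets M" for A N
    using that by (simp add: int integral_ind)
  let ?bad = "{w \<in> space M. \<exists>\<^sub>F N in sequentially. (prob B + e) * real N < X N w}"
  have "prob ?bad = 0"
  proof (rule ccontr)
    assume "prob ?bad \<noteq> 0"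
    then have pos: "prob ?bad > 0" by (simp add: zero_less_measure_iff)
    define a where "a = prob B + e / 2"
    have a: "0 < a" using \<open>0 < e\<close> by (simp add: a_def add_nonneg_pos)
    have "AE w in M. \<exists>\<^sub>F n in sequentially. a * real n < X n w"
      using upper_rate_almost_surely[OF X_meas nonneg super _ pos] \<open>0 < e\<close> by (simp add: a_def)
    from bounded_waiting_time[OF X_meas this, of "e / (4 * a)" 1]
    obtain L D where D [measurable]: "D \<in> sets M" and D_small: "prob D < e / (4 * a)"
      and D_good: "\<forall>w\<in>space M - D. \<exists>j. 1 \<le> j \<and> j \<le> L \<and> a * real j \<le> X j w"
      using a \<open>0 < e\<close> by (metis divide_pos_pos mult_pos_pos zero_less_numeral)
    obtain N :: nat where N: "4 * a * (real L + 2) / e < real N" "1 \<le> N"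
    proof -
      obtain N0 where "4 * a * (real L + 2) / e < real N0" using reals_Archimedean2 by blast
      then show thesis using that[of "Suc N0"] by simp
    qed
    have "expectation (\<lambda>w. a * (real N - real L - 2 * real 1 - real 1 * (\<Sum>k<N. indicator D ((T ^^ k) w))))
        \<le> expectation (X N)"
    proof (rule integral_mono)
      show "integrable M (X N)" unfolding X_def by (simp add: int)
      fix w assume "w \<in> space M"
      then show "a * (real N - real L - 2 * real 1 - real 1 * (\<Sum>k<N. indicator D ((T ^^ k) w))) \<le> X N w"
        using tiling_lower_bound[of 1 X a D L w N] nonneg super a D_good N(2) by auto
    qed (simp add: int)
    then have "a * (real N - real L - 2 - real N * prob D) \<le> real N * prob B"
      unfolding X_def by (simp add: E_sum int integral_ind prob_space)
    moreover have "real N * (a * prob D) \<le> real N * (e / 4)"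
      using D_small a by (intro mult_left_mono) (auto simp: field_simps)
    moreover have "a * (real L + 2) < real N * e / 4"
      using N(1) \<open>0 < e\<close> by (simp add: field_simps)
    ultimately show False
      unfolding a_def by (simp add: algebra_simps)
  qed
  then have "AE w in M. \<not> (\<exists>\<^sub>F N in sequentially. (prob B + e) * real N < X N w)"
    by (subst (asm) prob_eq_0) (auto simp: frequently_sequentially)
  then show ?thesis
    by (rule AE_mp) (auto simp: not_frequently not_less X_def)
qed

lemma visit_frequency_ge:
  assumes A [measurable]: "A \<in> sets M" and "0 < e"
  shows "AE w in M. \<forall>\<^sub>F N in sequentially. (prob A - e) * real N \<le> (\<Sum>k<N. indicator A ((T ^^ k) w))"
proof -
  have "AE w in M. \<forall>\<^sub>F N in sequentially.
      (\<Sum>k<N. indicator (space M - A) ((T ^^ k) w)) \<le> (prob (space M - A) + e) * real N"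
    by (rule visit_frequency_le) (use \<open>0 < e\<close> in auto)
  then show ?thesis
  proof (rule AE_mp, intro AE_I2 impI)
    fix w assume w: "w \<in> space M" and ev: "\<forall>\<^sub>F N in sequentially.
      (\<Sum>k<N. indicator (space M - A) ((T ^^ k) w)) \<le> (prob (space M - A) + e) * real N"
    have "(\<Sum>k<N. indicator (space M - A) ((T ^^ k) w)) =
        real N - (\<Sum>k<N. indicator A ((T ^^ k) w) :: real)" for N
    proof -
      have "(\<Sum>k<N. indicator (space M - A) ((T ^^ k) w)) =
          (\<Sum>k<N. 1 - indicator A ((T ^^ k) w) :: real)"
        using iterate_space[OF w] by (intro sum.cong) (auto simp: indicator_def)
      then show ?thesis by (simp add: sum_subtractf)
    qed
    with ev show "\<forall>\<^sub>F N in sequentially. (prob A - e) * real N \<le> (\<Sum>k<N. indicator A ((T ^^ k) w))"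
      by (simp add: prob_compl algebra_simps)
  qed
qed

text \<open>
  The limit \<open>\<gamma>\<close> is the supremum of the rates that are exceeded infinitely often with positive
  probability. Such rates are, up to an arbitrarily small loss, exceeded infinitely often almost surely, so
  almost every orbit can be tiled at any rate below \<open>\<gamma>\<close>; since the points where no short tile starts are
  visited with small frequency, the tiling bounds the lower growth rate by \<open>\<gamma>\<close> as well.
\<close>

lemma superadditive_ergodic_nonneg:
  assumes meas [measurable]: "\<And>n. X n \<in> borel_measurable M"
    and nonneg: "\<And>n w. n0 \<le> n \<Longrightarrow> w \<in> space M \<Longrightarrow> 0 \<le> X n w"
    and upper: "\<And>n w. n0 \<le> n \<Longrightarrow> w \<in> space M \<Longrightarrow> X n w \<le> C * real n"
    and super: "superadditive_from n0 X" and "1 \<le> n0"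
  obtains \<gamma> where "AE w in M. (\<lambda>n. X n w / real n) \<longlonglongrightarrow> \<gamma>"
proof -
  define E where "E c = {w \<in> space M. \<exists>\<^sub>F n in sequentially. c * real n < X n w}" for c
  have E_meas [measurable]: "E c \<in> sets M" for c
    unfolding E_def frequently_sequentially by measurable
  define S where "S = {c. prob (E c) > 0}"
  have "E (-1) = space M"
  proof -
    have "\<exists>n\<ge>m. -1 * real n < X n w" if "w \<in> space M" for w m
      using nonneg[of "max m n0" w] that \<open>1 \<le> n0\<close> by (intro exI[of _ "max m n0"]) (auto simp: max_def)
    then show ?thesis by (auto simp: E_def frequently_sequentially)
  qed
  then have S_ne: "-1 \<in> S" by (simp add: S_def prob_space)
  have S_bdd: "c \<le> C" if "c \<in> S" for c
  proof (rule ccontr)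
    assume "\<not> c \<le> C"
    have "w \<notin> E c" for w
    proof
      assume "w \<in> E c"
      then obtain n where n: "n \<ge> n0" "c * real n < X n w" "w \<in> space M"
        unfolding E_def frequently_sequentially by blast
      moreover have "C * real n \<le> c * real n" using \<open>\<not> c \<le> C\<close> by (intro mult_right_mono) auto
      ultimately show False using upper[of n w] by linarith
    qed
    then have "E c = {}" by blast
    then show False using that by (simp add: S_def)
  qed
  have bdd: "bdd_above S" using S_bdd by (auto simp: bdd_above_def)
  define \<gamma> where "\<gamma> = Sup S"
  have above: "AE w in M. \<forall>\<^sub>F n in sequentially. X n w \<le> c * real n" if "\<gamma> < c" for c
  proof -
    have "c \<notin> S" using cSup_upper[OF _ bdd, of c] that by (auto simp: \<gamma>_def)
    then have "prob (E c) = 0" by (simp add: S_def zero_less_measure_iff)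
    then have "AE w in M. \<not> (\<exists>\<^sub>F n in sequentially. c * real n < X n w)"
      using prob_eq_0[OF E_meas, of c] by (simp add: E_def)
    then show ?thesis by (rule AE_mp) (auto simp: not_frequently not_less)
  qed
  have below: "AE w in M. \<forall>\<^sub>F n in sequentially. c * real n \<le> X n w" if "c < \<gamma>" for c
  proof (cases "c < 0")
    case True
    have "\<forall>\<^sub>F n in sequentially. c * real n \<le> X n w" if "w \<in> space M" for w
      using eventually_ge_at_top[of n0]
    proof eventually_elim
      case (elim n)
      have "c * real n \<le> 0" using True by (simp add: mult_nonpos_nonneg)
      then show ?case using nonneg[OF elim that] by linarith
    qed
    then show ?thesis by simp
  next
    case False
    define a where "a = (c + \<gamma>) / 2"
    have a: "c < a" "a < \<gamma>" "0 < a" using False that by (auto simp: a_def)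
    obtain c' where c': "c' \<in> S" "a < c'"
      using less_cSup_iff[OF _ bdd, of a] S_ne a(2) by (auto simp: \<gamma>_def)
    have "AE w in M. \<exists>\<^sub>F n in sequentially. a * real n < X n w"
      using upper_rate_almost_surely[OF meas nonneg super c'(2)] c'(1) by (simp add: S_def E_def)
    note wait = bounded_waiting_time[OF meas this, where ?n0.0 = n0]
    have \<delta>: "0 < (a - c) / (4 * a * real n0)"
      using a \<open>1 \<le> n0\<close> by simp
    then obtain L D where D [measurable]: "D \<in> sets M" and D_small: "prob D < (a - c) / (4 * a * real n0)"
      and D_good: "\<forall>w\<in>space M - D. \<exists>j. n0 \<le> j \<and> j \<le> L \<and> a * real j \<le> X j w"
      using wait[OF \<delta>] by blast
    have "AE w in M. \<forall>\<^sub>F N in sequentially.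
        (\<Sum>k<N. indicator D ((T ^^ k) w)) \<le> (prob D + (a - c) / (4 * a * real n0)) * real N"
      by (rule visit_frequency_le[OF D \<delta>])
    then show ?thesis
    proof (rule AE_mp, intro AE_I2 impI)
      fix w assume w: "w \<in> space M" and ev: "\<forall>\<^sub>F N in sequentially.
        (\<Sum>k<N. indicator D ((T ^^ k) w)) \<le> (prob D + (a - c) / (4 * a * real n0)) * real N"
      have big: "\<forall>\<^sub>F N in sequentially. a * (real L + 2 * real n0) * 2 / (a - c) \<le> real N"
        using filterlim_real_sequentially by (simp add: filterlim_at_top)
      show "\<forall>\<^sub>F n in sequentially. c * real n \<le> X n w"
        using ev big eventually_ge_at_top[of n0]
      proof eventually_elim
        case (elim N)
        define s where "s = (\<Sum>k<N. indicator D ((T ^^ k) w) :: real)"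
        have "(prob D + (a - c) / (4 * a * real n0)) * real N
            \<le> ((a - c) / (4 * a * real n0) + (a - c) / (4 * a * real n0)) * real N"
          using D_small by (intro mult_right_mono) auto
        also have "\<dots> = (a - c) / (2 * a * real n0) * real N"
          by simp
        finally have "s \<le> (a - c) / (2 * a * real n0) * real N" 
          using elim(1) unfolding s_def by linarith
        then have "a * real n0 * s \<le> a * real n0 * ((a - c) / (2 * a * real n0) * real N)"
          using a by (intro mult_left_mono) auto
        also have "\<dots> = (a - c) / 2 * real N"
          using a \<open>1 \<le> n0\<close> by (simp add: field_simps)
        finally have 1: "a * real n0 * s \<le> (a - c) / 2 * real N" .
        have 2: "a * (real L + 2 * real n0) \<le> (a - c) / 2 * real N"
          using elim(2) a by (simp add: field_simps)
        have "c * real N \<le> a * (real N - real L - 2 * real n0 - real n0 * s)"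
          using 1 2 by (simp add: algebra_simps)
        also have "\<dots> \<le> X N w"
          unfolding s_def
          using tiling_lower_bound[OF nonneg super \<open>1 \<le> n0\<close> _ D_good w elim(3)] a by auto
        finally show ?case .
      qed
    qed
  qed
  have "AE w in M. \<forall>i. (\<forall>\<^sub>F n in sequentially. X n w \<le> (\<gamma> + 1 / real (Suc i)) * real n) \<and>
      (\<forall>\<^sub>F n in sequentially. (\<gamma> - 1 / real (Suc i)) * real n \<le> X n w)"
    unfolding AE_all_countable by (intro allI AE_conjI above below) auto
  then have "AE w in M. (\<lambda>n. X n w / real n) \<longlonglongrightarrow> \<gamma>"
  proof (rule AE_mp, intro AE_I2 impI)
    fix w assume *: "\<forall>i. (\<forall>\<^sub>F n in sequentially. X n w \<le> (\<gamma> + 1 / real (Suc i)) * real n) \<and>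
      (\<forall>\<^sub>F n in sequentially. (\<gamma> - 1 / real (Suc i)) * real n \<le> X n w)"
    show "(\<lambda>n. X n w / real n) \<longlonglongrightarrow> \<gamma>"
    proof (rule tendstoI)
      fix e :: real assume "0 < e"
      then obtain i where i: "1 / real (Suc i) < e" using nat_approx_posE by blast
      show "\<forall>\<^sub>F n in sequentially. dist (X n w / real n) \<gamma> < e"
        using *[THEN spec, of i, THEN conjunct1] *[THEN spec, of i, THEN conjunct2] eventually_gt_at_top[of 0]
      proof eventually_elim
        case (elim n)
        have "X n w / real n \<le> \<gamma> + 1 / real (Suc i)" "\<gamma> - 1 / real (Suc i) \<le> X n w / real n"
          using elim by (simp_all only: pos_divide_le_eq pos_le_divide_eq of_nat_0_less_iff)
        then show ?case using i by (simp add: dist_real_def)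
      qed
    qed
  qed
  then show thesis by (rule that)
qed

text \<open>
  Adding \<open>C * n\<close> preserves superadditivity and makes the sequence nonnegative.
\<close>

theorem superadditive_ergodic:
  assumes meas [measurable]: "\<And>n. X n \<in> borel_measurable M"
    and bound: "\<And>n w. n0 \<le> n \<Longrightarrow> w \<in> space M \<Longrightarrow> \<bar>X n w\<bar> \<le> C * real n"
    and super: "superadditive_from n0 X" and "1 \<le> n0"
  obtains \<gamma> where "AE w in M. (\<lambda>n. X n w / real n) \<longlonglongrightarrow> \<gamma>"
proof -
  define Y where "Y n w = X n w + C * real n" for n w
  have "\<exists>\<gamma>. AE w in M. (\<lambda>n. Y n w / real n) \<longlonglongrightarrow> \<gamma>"
  proof (rule superadditive_ergodic_nonneg[of Y n0 "2 * C"])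
    show "Y n \<in> borel_measurable M" for n
      unfolding Y_def by measurable
    show "0 \<le> Y n w" "Y n w \<le> 2 * C * real n" if "n0 \<le> n" "w \<in> space M" for n w
      using bound[OF that] by (auto simp: Y_def abs_le_iff)
    show "superadditive_from n0 Y"
      using super by (auto simp: superadditive_from_def Y_def algebra_simps)
    show "1 \<le> n0" by fact
  qed blast
  then obtain \<gamma> where "AE w in M. (\<lambda>n. Y n w / real n) \<longlonglongrightarrow> \<gamma>" by blast
  then have "AE w in M. (\<lambda>n. X n w / real n) \<longlonglongrightarrow> \<gamma> - C"
  proof (rule AE_mp, intro AE_I2 impI)
    fix w assume "(\<lambda>n. Y n w / real n) \<longlonglongrightarrow> \<gamma>"
    then have "(\<lambda>n. Y n w / real n - C) \<longlonglongrightarrow> \<gamma> - C" by (intro tendsto_intros)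
    moreover have "\<forall>\<^sub>F n in sequentially. Y n w / real n - C = X n w / real n"
      using eventually_gt_at_top[of 0] by eventually_elim (simp add: Y_def field_simps)
    ultimately show "(\<lambda>n. X n w / real n) \<longlonglongrightarrow> \<gamma> - C"
      by (rule Lim_transform_eventually)
  qed
  then show thesis by (rule that)
qed

end

section \<open>Partition functions of the renewal process\<close>

context renewal_process
begin

abbreviation K :: "nat \<Rightarrow> real" where
  "K \<equiv> inter_arrival M \<tau>"

abbreviation gap :: "nat \<Rightarrow> 'a \<Rightarrow> nat" where
  "gap i x \<equiv> \<tau> (Suc i) x - \<tau> i x"

text \<open>
  The number \<open>f n\<close> is the energy collected by a contact at \<open>n\<close>; keeping it arbitrary allows shifts of
  the environment to be treated as a change of \<open>f\<close>.
\<close>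

definition weight :: "(nat \<Rightarrow> real) \<Rightarrow> nat \<Rightarrow> 'a \<Rightarrow> real" where
  "weight f N x = exp (\<Sum>n=1..N. f n * contact \<tau> n x)"

definition free :: "(nat \<Rightarrow> real) \<Rightarrow> nat \<Rightarrow> real" where
  "free f N = expectation (weight f N)"

definition pinned :: "(nat \<Rightarrow> real) \<Rightarrow> nat \<Rightarrow> real" where
  "pinned f N = expectation (\<lambda>x. weight f N x * contact \<tau> N x)"

lemma measurable_renewal' [measurable]: "\<tau> i \<in> measurable M (count_space UNIV)"
  by (rule measurable_renewal)

lemma contact_measurable [measurable]: "contact \<tau> n \<in> borel_measurable M"
proof -
  have "contact \<tau> n = (\<lambda>x. of_bool (\<exists>i. n = \<tau> i x))"
    by (auto simp: contact_def fun_eq_iff image_iff)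
  then show ?thesis by simp
qed

lemma contact_nonneg: "0 \<le> contact \<tau> n x" and contact_le_1: "contact \<tau> n x \<le> 1"
  by (auto simp: contact_def)

lemma weight_measurable [measurable]: "weight f N \<in> borel_measurable M"
  unfolding weight_def by measurable

lemma weight_pos: "0 < weight f N x"
  by (simp add: weight_def)

lemma weight_le: "weight f N x \<le> exp (\<Sum>n=1..N. \<bar>f n\<bar>)"
  unfolding weight_def exp_le_cancel_iff
proof (rule sum_mono)
  fix n
  show "f n * contact \<tau> n x \<le> \<bar>f n\<bar>" by (auto simp: contact_def)
qed

lemma integrable_weight_mult:
  assumes [measurable]: "g \<in> borel_measurable M" and "\<And>x. x \<in> space M \<Longrightarrow> \<bar>g x\<bar> \<le> 1"
  shows "integrable M (\<lambda>x. weight f N x * g x)"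
proof (rule integrable_const_bound[of _ "exp (\<Sum>n=1..N. \<bar>f n\<bar>)"])
  show "AE x in M. norm (weight f N x * g x) \<le> exp (\<Sum>n=1..N. \<bar>f n\<bar>)"
  proof (rule AE_I2)
    fix x assume "x \<in> space M"
    have "norm (weight f N x * g x) = weight f N x * \<bar>g x\<bar>"
      using weight_pos[of f N x] by (simp add: abs_mult)
    also have "\<dots> \<le> exp (\<Sum>n=1..N. \<bar>f n\<bar>) * 1"
      using weight_le assms(2)[OF \<open>x \<in> space M\<close>] by (intro mult_mono) auto
    finally show "norm (weight f N x * g x) \<le> exp (\<Sum>n=1..N. \<bar>f n\<bar>)" by simp
  qed
qed simp

lemma strict_mono_renewal: "x \<in> space M \<Longrightarrow> strict_mono (\<lambda>i. \<tau> i x)"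
  by (simp add: strict_mono_Suc_iff renewal_less)

lemma renewal_eq_iff: "x \<in> space M \<Longrightarrow> \<tau> i x = \<tau> j x \<longleftrightarrow> i = j"
  using strict_mono_eq[OF strict_mono_renewal] by blast

lemma le_renewal: "x \<in> space M \<Longrightarrow> i \<le> \<tau> i x"
  using strict_mono_imp_increasing[OF strict_mono_renewal] by blast

lemma renewal_eq_sum_gaps:
  assumes "x \<in> space M"
  shows "\<tau> i x = (\<Sum>m<i. gap m x)"
proof (induction i)
  case 0
  then show ?case using renewal_0[OF assms] by simp
next
  case (Suc i)
  then show ?case using renewal_less[OF assms, of i] by simp
qed

lemma prob_gap: "prob {x \<in> space M. gap i x \<in> S} = prob {x \<in> space M. \<tau> 1 x \<in> S}"
proof -
  have "prob {x \<in> space M. gap i x \<in> S} = measure (distr M (count_space UNIV) (gap i)) S"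
    by (subst measure_distr) (auto simp: vimage_def Int_def conj_commute)
  also have "\<dots> = prob {x \<in> space M. \<tau> 1 x \<in> S}"
    unfolding distr_increments by (subst measure_distr) (auto simp: vimage_def Int_def conj_commute)
  finally show ?thesis .
qed

text \<open>
  On the event \<open>\<tau> i = j\<close> the contacts up to \<open>j\<close> are \<open>\<tau> 1, \<dots>, \<tau> i\<close>, so the weight is a function of the
  first \<open>i\<close> increments and therefore independent of the next one.
\<close>

lemma expectation_past_times_gap:
  "expectation (\<lambda>x. weight f j x * of_bool (\<tau> i x = j) * of_bool (gap i x \<in> S))
    = expectation (\<lambda>x. weight f j x * of_bool (\<tau> i x = j)) * prob {x \<in> space M. \<tau> 1 x \<in> S}"
proof -
  define g :: "(nat \<Rightarrow> nat) \<Rightarrow> real" where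
    "g v = exp (\<Sum>n=1..j. f n * of_bool (\<exists>l\<le>i. (\<Sum>m<l. v m) = n)) * of_bool ((\<Sum>m<i. v m) = j)" for v
  define past where "past x = restrict (\<lambda>m. gap m x) {..<i}" for x
  define now where "now x = restrict (\<lambda>m. gap m x) {i}" for x
  have past_eq: "g (past x) = weight f j x * of_bool (\<tau> i x = j)" if x: "x \<in> space M" for x
  proof -
    have sums: "(\<Sum>m<l. past x m) = \<tau> l x" if "l \<le> i" for l
      by (subst renewal_eq_sum_gaps[OF x]) (use that in \<open>auto simp: past_def intro!: sum.cong\<close>)
    have "contact \<tau> n x = of_bool (\<exists>l\<le>i. (\<Sum>m<l. past x m) = n)" if "\<tau> i x = j" "n \<le> j" for n
    proof -
      have "l \<le> i" if "\<tau> l x = n" for l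
        using \<open>\<tau> i x = j\<close> \<open>n \<le> j\<close> that strict_mono_less_eq[OF strict_mono_renewal[OF x]] by blast
      then show ?thesis by (auto simp: contact_def sums)
    qed
    then show ?thesis
      by (auto simp: g_def weight_def sums intro!: sum.cong)
  qed
  have indep: "indep_var (PiM {..<i} (\<lambda>_. count_space UNIV)) past (PiM {i} (\<lambda>_. count_space UNIV)) now"
    unfolding past_def now_def by (rule indep_var_restrict[OF indep_increments]) auto
  have any_meas: "h \<in> borel_measurable (PiM J (\<lambda>_. count_space UNIV))" if "finite J"
    for h :: "(nat \<Rightarrow> nat) \<Rightarrow> real" and J
    using that by (subst count_space_PiM_finite) auto
  have "indep_var borel (g \<circ> past) borel ((\<lambda>v. of_bool (v i \<in> S)) \<circ> now)"
    by (rule indep_var_compose[OF indep any_meas any_meas]) auto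
  then have indep': "indep_var borel (\<lambda>x. g (past x)) borel (\<lambda>x. of_bool (gap i x \<in> S) :: real)"
    by (simp add: comp_def now_def)
  have int_past: "integrable M (\<lambda>x. g (past x))"
  proof (subst Bochner_Integration.integrable_cong[OF refl past_eq])
    show "integrable M (\<lambda>x. weight f j x * of_bool (\<tau> i x = j))"
      by (rule integrable_weight_mult) auto
  qed auto
  have int_now: "integrable M (\<lambda>x. of_bool (gap i x \<in> S) :: real)"
    by (rule integrable_const_bound[of _ 1]) auto
  have "expectation (\<lambda>x. of_bool (gap i x \<in> S)) = prob {x \<in> space M. gap i x \<in> S}"
  proof -
    have "expectation (\<lambda>x. of_bool (gap i x \<in> S)) = expectation (indicator {x \<in> space M. gap i x \<in> S})"
      by (rule Bochner_Integration.integral_cong) (auto simp: indicator_def)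
    also have "\<dots> = prob {x \<in> space M. gap i x \<in> S}"
      by simp
    finally show ?thesis .
  qed
  then have now_prob: "expectation (\<lambda>x. of_bool (gap i x \<in> S)) = prob {x \<in> space M. \<tau> 1 x \<in> S}"
    by (simp add: prob_gap)
  have "expectation (\<lambda>x. weight f j x * of_bool (\<tau> i x = j) * of_bool (gap i x \<in> S))
      = expectation (\<lambda>x. g (past x) * of_bool (gap i x \<in> S))"
    by (rule Bochner_Integration.integral_cong) (auto simp: past_eq)
  also have "\<dots> = expectation (\<lambda>x. g (past x)) * expectation (\<lambda>x. of_bool (gap i x \<in> S))"
    by (rule indep_var_lebesgue_integral[OF indep' int_past int_now])
  also have "expectation (\<lambda>x. g (past x)) = expectation (\<lambda>x. weight f j x * of_bool (\<tau> i x = j))"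
    by (rule Bochner_Integration.integral_cong) (auto simp: past_eq)
  finally show ?thesis by (simp add: now_prob)
qed

lemma sum_of_bool_renewal:
  assumes x: "x \<in> space M" and "j \<le> N"
  shows "(\<Sum>i\<le>N. of_bool (\<tau> i x = j)) = contact \<tau> j x"
proof (cases "\<exists>i. \<tau> i x = j")
  case True
  then obtain i where i: "\<tau> i x = j" by blast
  then have "i \<le> N" using le_renewal[OF x, of i] \<open>j \<le> N\<close> by simp
  have "(\<Sum>k\<le>N. of_bool (\<tau> k x = j)) = (\<Sum>k\<le>N. if k = i then 1 else 0 :: real)"
    using i renewal_eq_iff[OF x] by (intro sum.cong) auto
  also have "\<dots> = 1" using \<open>i \<le> N\<close> by (simp add: sum.delta)
  finally show ?thesis using i by (auto simp: contact_def)
next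
  case False
  then show ?thesis by (auto simp: contact_def)
qed

text \<open>
  Here \<open>j\<close> stands for the last renewal up to \<open>N\<close> and \<open>i\<close> for its index; the assumption on \<open>Q\<close> says that
  the next increment leaves \<open>{..N}\<close>.
\<close>

lemma expectation_last_renewal:
  assumes "\<And>d j. Q j d \<Longrightarrow> N < j + d"
  shows "expectation (\<lambda>x. \<Sum>j\<le>N. \<Sum>i\<le>N. weight f j x * of_bool (\<tau> i x = j) * of_bool (Q j (gap i x)))
    = (\<Sum>j\<le>N. pinned f j * prob {x \<in> space M. Q j (\<tau> 1 x)})"
proof -
  have int: "integrable M (\<lambda>x. weight f j x * of_bool (\<tau> i x = j) * of_bool (Q j (gap i x)))" for i j
    using integrable_weight_mult[of "\<lambda>x. of_bool (\<tau> i x = j) * of_bool (Q j (gap i x))" f j]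
    by (simp add: mult.assoc)
  have int': "integrable M (\<lambda>x. weight f j x * of_bool (\<tau> i x = j))" for i j
    by (rule integrable_weight_mult) auto
  have split_gap: "expectation (\<lambda>x. weight f j x * of_bool (\<tau> i x = j) * of_bool (Q j (gap i x)))
      = expectation (\<lambda>x. weight f j x * of_bool (\<tau> i x = j)) * prob {x \<in> space M. Q j (\<tau> 1 x)}" for i j
    using expectation_past_times_gap[of f j i "Collect (Q j)"] by simp
  have "expectation (\<lambda>x. \<Sum>j\<le>N. \<Sum>i\<le>N. weight f j x * of_bool (\<tau> i x = j) * of_bool (Q j (gap i x)))
      = (\<Sum>j\<le>N. \<Sum>i\<le>N. expectation (\<lambda>x. weight f j x * of_bool (\<tau> i x = j) * of_bool (Q j (gap i x))))"
    by (simp only: Bochner_Integration.integral_sum Bochner_Integration.integrable_sum int)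
  also have "\<dots> = (\<Sum>j\<le>N. (\<Sum>i\<le>N. expectation (\<lambda>x. weight f j x * of_bool (\<tau> i x = j)))
      * prob {x \<in> space M. Q j (\<tau> 1 x)})"
    by (simp only: split_gap sum_distrib_right)
  also have "\<dots> = (\<Sum>j\<le>N. pinned f j * prob {x \<in> space M. Q j (\<tau> 1 x)})"
  proof (rule sum.cong[OF refl])
    fix j assume "j \<in> {..N}"
    have "(\<Sum>i\<le>N. expectation (\<lambda>x. weight f j x * of_bool (\<tau> i x = j)))
        = expectation (\<lambda>x. weight f j x * (\<Sum>i\<le>N. of_bool (\<tau> i x = j)))"
      by (simp only: Bochner_Integration.integral_sum int' sum_distrib_left)
    also have "\<dots> = pinned f j"
      unfolding pinned_def using \<open>j \<in> {..N}\<close>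
      by (intro Bochner_Integration.integral_cong refl) (simp only: sum_of_bool_renewal atMost_iff)
    finally show "(\<Sum>i\<le>N. expectation (\<lambda>x. weight f j x * of_bool (\<tau> i x = j)))
      * prob {x \<in> space M. Q j (\<tau> 1 x)} = pinned f j * prob {x \<in> space M. Q j (\<tau> 1 x)}" by simp
  qed
  finally show ?thesis .
qed

text \<open>
  Only the pair of the last renewal up to \<open>N\<close> and its index can contribute to
  the sum, and the weight does not change between this renewal and \<open>N\<close>.
\<close>

lemma last_renewal_sum:
  assumes x: "x \<in> space M" and Q: "\<And>d j. Q j d \<Longrightarrow> N < j + d"
    and i0: "\<tau> i0 x \<le> N" "N < \<tau> (Suc i0) x"
  shows "(\<Sum>j\<le>N. \<Sum>i\<le>N. weight f j x * of_bool (\<tau> i x = j) * of_bool (Q j (gap i x)))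
    = weight f N x * of_bool (Q (\<tau> i0 x) (gap i0 x))"
proof -
  have uniq: "i = i0" if "\<tau> i x \<le> N" "N < \<tau> (Suc i) x" for i
  proof -
    have "i < Suc i0" "i0 < Suc i"
      using that i0 strict_mono_less[OF strict_mono_renewal[OF x]] by (meson le_less_trans)+
    then show ?thesis by simp
  qed
  have Qi: "i = i0" if "Q (\<tau> i x) (gap i x)" "\<tau> i x \<le> N" for i
    using uniq[OF that(2)] Q[OF that(1)] renewal_less[OF x, of i] by simp
  have "i0 \<le> N" using le_renewal[OF x, of i0] i0 by simp
  have "(\<Sum>j\<le>N. \<Sum>i\<le>N. weight f j x * of_bool (\<tau> i x = j) * of_bool (Q j (gap i x)))
      = (\<Sum>j\<le>N. \<Sum>i\<le>N. if j = \<tau> i0 x then (if i = i0 then weight f j x * of_bool (Q j (gap i x)) else 0) else 0)"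
    by (intro sum.cong refl) (use Qi in auto)
  also have "\<dots> = (\<Sum>j\<le>N. if j = \<tau> i0 x then (\<Sum>i\<le>N. if i = i0 then weight f j x * of_bool (Q j (gap i x)) else 0) else 0)"
    by (intro sum.cong refl) simp
  also have "\<dots> = weight f (\<tau> i0 x) x * of_bool (Q (\<tau> i0 x) (gap i0 x))"
    using i0 \<open>i0 \<le> N\<close> by (simp add: sum.delta)
  also have "weight f (\<tau> i0 x) x = weight f N x"
  proof -
    have no_contact: "contact \<tau> n x = 0" if n: "\<tau> i0 x < n" "n \<le> N" for n
    proof -
      have "\<tau> l x \<noteq> n" for l
      proof
        assume "\<tau> l x = n"
        then have "i0 < l" "l < Suc i0"
          using n i0 strict_mono_less[OF strict_mono_renewal[OF x]] by (meson le_less_trans)+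
        then show False by simp
      qed
      then show ?thesis by (auto simp: contact_def)
    qed
    have "(\<Sum>n=1..\<tau> i0 x. f n * contact \<tau> n x) = (\<Sum>n=1..N. f n * contact \<tau> n x)"
      by (rule sum.mono_neutral_left) (use i0 no_contact in auto)
    then show ?thesis by (simp add: weight_def)
  qed
  finally show ?thesis .
qed

lemma last_renewal_exists:
  assumes x: "x \<in> space M"
  obtains i where "\<tau> i x \<le> N" "N < \<tau> (Suc i) x"
proof -
  define i where "i = (LEAST i. N < \<tau> (Suc i) x)"
  have ex: "N < \<tau> (Suc N) x" using le_renewal[OF x, of "Suc N"] by simp
  have "N < \<tau> (Suc i) x" unfolding i_def using ex by (rule LeastI)
  moreover have "\<tau> i x \<le> N"
  proof (cases i)
    case 0
    then show ?thesis using renewal_0[OF x] by simp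
  next
    case (Suc k)
    then have "\<not> N < \<tau> (Suc k) x" using not_less_Least[of k "\<lambda>i. N < \<tau> (Suc i) x"] by (simp add: i_def)
    then show ?thesis using Suc by simp
  qed
  ultimately show thesis using that by blast
qed

lemma pinned_0: "pinned f 0 = 1"
proof -
  have "pinned f 0 = expectation (\<lambda>x. 1)"
    unfolding pinned_def
    by (rule Bochner_Integration.integral_cong)
       (auto simp: weight_def contact_def intro!: image_eqI[of _ _ 0] dest: renewal_0)
  then show ?thesis by (simp add: prob_space)
qed

lemma pinned_Suc:
  "pinned f (Suc N) = exp (f (Suc N)) * (\<Sum>j\<le>N. pinned f j * K (Suc N - j))"
proof -
  define Q where "Q j d \<longleftrightarrow> j + d = Suc N" for j d
  have Q: "N < j + d" if "Q j d" for j d using that by (simp add: Q_def)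
  have eq: "weight f (Suc N) x * contact \<tau> (Suc N) x = exp (f (Suc N)) *
      (\<Sum>j\<le>N. \<Sum>i\<le>N. weight f j x * of_bool (\<tau> i x = j) * of_bool (Q j (gap i x)))"
    if x: "x \<in> space M" for x
  proof -
    obtain i0 where i0: "\<tau> i0 x \<le> N" "N < \<tau> (Suc i0) x" using last_renewal_exists[OF x] .
    have decomp: "(\<Sum>j\<le>N. \<Sum>i\<le>N. weight f j x * of_bool (\<tau> i x = j) * of_bool (Q j (gap i x)))
        = weight f N x * of_bool (Q (\<tau> i0 x) (gap i0 x))"
      using Q by (rule last_renewal_sum[OF x _ i0])
    have "contact \<tau> (Suc N) x = of_bool (Q (\<tau> i0 x) (gap i0 x))"
    proof -
      have "\<tau> (Suc i0) x = Suc N" if l: "\<tau> l x = Suc N" for l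
      proof -
        have "i0 < l" using i0 l strict_mono_less[OF strict_mono_renewal[OF x]] by (metis less_Suc_eq_le)
        then have "\<tau> (Suc i0) x \<le> \<tau> l x"
          using strict_mono_less_eq[OF strict_mono_renewal[OF x]] by (simp add: Suc_leI)
        then show ?thesis using i0 l by simp
      qed
      then have "(\<exists>l. \<tau> l x = Suc N) \<longleftrightarrow> \<tau> (Suc i0) x = Suc N" by blast
      moreover have "\<tau> i0 x + gap i0 x = \<tau> (Suc i0) x" using i0 by simp
      moreover have "contact \<tau> (Suc N) x = of_bool (\<exists>l. \<tau> l x = Suc N)"
        by (simp add: contact_def image_iff eq_commute)
      ultimately show ?thesis by (simp only: Q_def)
    qed
    moreover have "weight f (Suc N) x = weight f N x * exp (f (Suc N))" if "contact \<tau> (Suc N) x \<noteq> 0"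
    proof -
      have "contact \<tau> (Suc N) x = 1" using that by (auto simp: contact_def)
      then show ?thesis by (simp add: weight_def exp_add)
    qed
    ultimately show ?thesis
      unfolding decomp by (cases "Q (\<tau> i0 x) (gap i0 x)") simp_all
  qed
  have last: "expectation (\<lambda>x. \<Sum>j\<le>N. \<Sum>i\<le>N. weight f j x * of_bool (\<tau> i x = j) * of_bool (Q j (gap i x)))
      = (\<Sum>j\<le>N. pinned f j * prob {x \<in> space M. Q j (\<tau> 1 x)})"
    using Q by (rule expectation_last_renewal)
  have "pinned f (Suc N) = expectation (\<lambda>x. exp (f (Suc N)) *
      (\<Sum>j\<le>N. \<Sum>i\<le>N. weight f j x * of_bool (\<tau> i x = j) * of_bool (Q j (gap i x))))"
    unfolding pinned_def by (rule Bochner_Integration.integral_cong[OF refl eq])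
  also have "\<dots> = exp (f (Suc N)) * (\<Sum>j\<le>N. pinned f j * prob {x \<in> space M. Q j (\<tau> 1 x)})"
    by (simp only: integral_mult_right_zero last)
  also have "(\<Sum>j\<le>N. pinned f j * prob {x \<in> space M. Q j (\<tau> 1 x)}) = (\<Sum>j\<le>N. pinned f j * K (Suc N - j))"
  proof (rule sum.cong[OF refl])
    fix j assume "j \<in> {..N}"
    then have "Q j d \<longleftrightarrow> d = Suc N - j" for d by (auto simp: Q_def)
    then show "pinned f j * prob {x \<in> space M. Q j (\<tau> 1 x)} = pinned f j * K (Suc N - j)"
      by (simp add: inter_arrival_def)
  qed
  finally show ?thesis .
qed

lemma free_eq_sum_pinned:
  "free f N = (\<Sum>j\<le>N. pinned f j * prob {x \<in> space M. N - j < \<tau> 1 x})"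
proof -
  define Q where "Q j d \<longleftrightarrow> N < j + d" for j d
  have Q: "N < j + d" if "Q j d" for j d using that by (simp add: Q_def)
  have eq: "weight f N x = (\<Sum>j\<le>N. \<Sum>i\<le>N. weight f j x * of_bool (\<tau> i x = j) * of_bool (Q j (gap i x)))"
    if x: "x \<in> space M" for x
  proof -
    obtain i0 where i0: "\<tau> i0 x \<le> N" "N < \<tau> (Suc i0) x" using last_renewal_exists[OF x] .
    have decomp: "(\<Sum>j\<le>N. \<Sum>i\<le>N. weight f j x * of_bool (\<tau> i x = j) * of_bool (Q j (gap i x)))
        = weight f N x * of_bool (Q (\<tau> i0 x) (gap i0 x))"
      using Q by (rule last_renewal_sum[OF x _ i0])
    show ?thesis unfolding decomp using i0 by (simp add: Q_def)
  qed
  have last: "expectation (\<lambda>x. \<Sum>j\<le>N. \<Sum>i\<le>N. weight f j x * of_bool (\<tau> i x = j) * of_bool (Q j (gap i x)))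
      = (\<Sum>j\<le>N. pinned f j * prob {x \<in> space M. Q j (\<tau> 1 x)})"
    using Q by (rule expectation_last_renewal)
  have "free f N = expectation
      (\<lambda>x. \<Sum>j\<le>N. \<Sum>i\<le>N. weight f j x * of_bool (\<tau> i x = j) * of_bool (Q j (gap i x)))"
    unfolding free_def by (rule Bochner_Integration.integral_cong[OF refl eq])
  also have "\<dots> = (\<Sum>j\<le>N. pinned f j * prob {x \<in> space M. Q j (\<tau> 1 x)})"
    by (rule last)
  also have "\<dots> = (\<Sum>j\<le>N. pinned f j * prob {x \<in> space M. N - j < \<tau> 1 x})"
    by (intro sum.cong refl arg_cong2[where f = "(*)"] arg_cong[where f = prob]) (auto simp: Q_def)
  finally show ?thesis .
qed

lemma K_nonneg: "0 \<le> K n"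
  by (simp add: inter_arrival_def)

lemma K_0: "K 0 = 0"
proof -
  have "{x \<in> space M. \<tau> 1 x = 0} = {}"
    using renewal_less[of _ 0] by fastforce
  then show ?thesis unfolding inter_arrival_def by (simp only: measure_empty)
qed

lemma K_sums_1: "K sums 1"
proof -
  have "(\<lambda>n. prob {x \<in> space M. \<tau> 1 x = n}) sums prob (\<Union>n. {x \<in> space M. \<tau> 1 x = n})"
    by (rule finite_measure_UNION) (auto simp: disjoint_family_on_def)
  moreover have "(\<Union>n. {x \<in> space M. \<tau> 1 x = n}) = space M" by auto
  ultimately show ?thesis by (simp only: inter_arrival_def[abs_def] prob_space)
qed

lemma pinned_nonneg: "0 \<le> pinned f n"
  unfolding pinned_def
  by (rule Bochner_Integration.integral_nonneg)
     (simp add: weight_pos less_imp_le contact_nonneg mult_nonneg_nonneg)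

lemma pinned_cong:
  assumes "\<And>n. 1 \<le> n \<Longrightarrow> n \<le> N \<Longrightarrow> f n = g n"
  shows "pinned f N = pinned g N"
proof -
  have "weight f N x = weight g N x" for x
    unfolding weight_def by (rule arg_cong[where f = exp]) (rule sum.cong, use assms in auto)
  then show ?thesis by (simp add: pinned_def)
qed

lemma pinned_step_ge:
  assumes "j < n"
  shows "exp (f n) * (pinned f j * K (n - j)) \<le> pinned f n"
proof -
  obtain N where N: "n = Suc N" "j \<le> N" using assms by (cases n) auto
  have "pinned f j * K (Suc N - j) \<le> (\<Sum>j\<le>N. pinned f j * K (Suc N - j))"
    by (rule member_le_sum) (use N in \<open>auto simp: pinned_nonneg K_nonneg\<close>)
  then show ?thesis by (simp add: N(1) pinned_Suc)
qed

lemma pinned_ge_K: "1 \<le> n \<Longrightarrow> exp (f n) * K n \<le> pinned f n"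
  using pinned_step_ge[of 0 n f] by (simp add: pinned_0)

text \<open>
  In the renewal equation at \<open>n + m\<close>, keep only the last steps that start at or after \<open>n\<close>; by induction
  these already account for the trajectories that touch \<open>n\<close>.
\<close>

lemma pinned_superadditive:
  "pinned f n * pinned (\<lambda>k. f (n + k)) m \<le> pinned f (n + m)"
proof (induction m rule: less_induct)
  case (less m)
  show ?case
  proof (cases m)
    case 0
    then show ?thesis by (simp add: pinned_0)
  next
    case (Suc l)
    have "pinned f n * pinned (\<lambda>k. f (n + k)) m
        = exp (f (n + m)) * (\<Sum>j\<le>l. pinned f n * pinned (\<lambda>k. f (n + k)) j * K (Suc l - j))"
      by (simp add: Suc pinned_Suc sum_distrib_left mult_ac)
    also have "\<dots> \<le> exp (f (n + m)) * (\<Sum>j\<le>l. pinned f (n + j) * K (Suc l - j))"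
      using less.IH Suc by (intro mult_left_mono sum_mono mult_right_mono) (auto simp: K_nonneg)
    also have "(\<Sum>j\<le>l. pinned f (n + j) * K (Suc l - j))
        = (\<Sum>j\<in>(\<lambda>j. n + j) ` {..l}. pinned f j * K (Suc (n + l) - j))"
      by (subst sum.reindex) (auto intro!: sum.cong)
    also have "exp (f (n + m)) * \<dots> \<le> exp (f (n + m)) * (\<Sum>j\<le>n + l. pinned f j * K (Suc (n + l) - j))"
      by (intro mult_left_mono sum_mono2) (auto simp: K_nonneg pinned_nonneg)
    also have "\<dots> = pinned f (n + m)"
      by (simp add: Suc pinned_Suc)
    finally show ?thesis .
  qed
qed

lemma integrable_weight: "integrable M (weight f N)"
  using integrable_weight_mult[of "\<lambda>_. 1" f N] by simp

lemma integrable_weight_contact: "integrable M (\<lambda>x. weight f N x * contact \<tau> n x)"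
  by (rule integrable_weight_mult) (use contact_nonneg contact_le_1 in \<open>auto simp: abs_le_iff intro: order_trans[of _ 0]\<close>)

lemma free_pos: "0 < free f N"
proof -
  have "exp (- (\<Sum>n=1..N. \<bar>f n\<bar>)) = expectation (\<lambda>x. exp (- (\<Sum>n=1..N. \<bar>f n\<bar>)))"
    by (simp add: prob_space)
  also have "\<dots> \<le> free f N"
    unfolding free_def
  proof (rule integral_mono)
    show "exp (- (\<Sum>n=1..N. \<bar>f n\<bar>)) \<le> weight f N x" for x
      unfolding weight_def exp_le_cancel_iff sum_negf[symmetric]
      by (rule sum_mono) (auto simp: contact_def)
  qed (simp_all add: integrable_weight)
  finally show ?thesis using exp_gt_zero less_le_trans by blast
qed

lemma free_0: "free (\<lambda>_. 0) N = 1"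
proof -
  have "weight (\<lambda>_. 0) N = (\<lambda>x. 1)" by (simp add: weight_def fun_eq_iff)
  then show ?thesis by (simp add: free_def prob_space)
qed

lemma free_mono:
  assumes "\<And>n. 1 \<le> n \<Longrightarrow> n \<le> N \<Longrightarrow> f n \<le> g n"
  shows "free f N \<le> free g N"
  unfolding free_def
proof (rule integral_mono)
  show "weight f N x \<le> weight g N x" for x
    unfolding weight_def exp_le_cancel_iff
    by (intro sum_mono mult_right_mono) (use assms in \<open>auto simp: contact_nonneg\<close>)
qed (rule integrable_weight)+

lemma free_shift_le:
  assumes "0 \<le> d"
  shows "free (\<lambda>n. f n + d) N \<le> exp (d * real N) * free f N"
proof -
  have "free (\<lambda>n. f n + d) N \<le> expectation (\<lambda>x. exp (d * real N) * weight f N x)"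
    unfolding free_def
  proof (rule integral_mono)
    show "weight (\<lambda>n. f n + d) N x \<le> exp (d * real N) * weight f N x" for x
    proof -
      have "(\<Sum>n=1..N. (f n + d) * contact \<tau> n x) \<le> (\<Sum>n=1..N. d + f n * contact \<tau> n x)"
        by (rule sum_mono) (use assms in \<open>auto simp: contact_def\<close>)
      also have "\<dots> = d * real N + (\<Sum>n=1..N. f n * contact \<tau> n x)"
        by (simp add: sum.distrib)
      finally show ?thesis by (simp add: weight_def exp_add[symmetric])
    qed
  qed (simp_all add: integrable_weight)
  then show ?thesis by (simp add: free_def)
qed

lemma free_le_1:
  assumes "\<And>n. f n \<le> 0"
  shows "free f N \<le> 1"
proof -
  have "free f N \<le> free (\<lambda>_. 0) N" using assms by (intro free_mono) auto
  also have "\<dots> = 1" by (rule free_0)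
  finally show ?thesis .
qed

lemma pinned_le_free: "pinned f N \<le> free f N"
  unfolding pinned_def free_def
proof (rule integral_mono)
  show "weight f N x * contact \<tau> N x \<le> weight f N x" for x
    using weight_pos[of f N x] contact_le_1[of N x] by (simp add: mult_left_le)
qed (rule integrable_weight_contact integrable_weight)+

lemma free_le_exp:
  assumes "\<And>n. f n \<le> b" and "0 \<le> b"
  shows "free f N \<le> exp (b * real N)"
proof -
  have "free f N \<le> free (\<lambda>n. 0 + b) N" using assms(1) by (intro free_mono) auto
  also have "\<dots> \<le> exp (b * real N) * free (\<lambda>_. 0) N" using free_shift_le[OF assms(2)] .
  also have "\<dots> \<le> exp (b * real N) * 1" by (intro mult_left_mono free_le_1) auto
  finally show ?thesis by simp
qed

lemma K_le_free: "K (Suc N) \<le> free f N"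
proof -
  have "K (Suc N) \<le> prob {x \<in> space M. N < \<tau> 1 x}"
    unfolding inter_arrival_def by (rule finite_measure_mono) auto
  also have "\<dots> = pinned f 0 * prob {x \<in> space M. N - 0 < \<tau> 1 x}"
    by (simp add: pinned_0)
  also have "\<dots> \<le> (\<Sum>j\<le>N. pinned f j * prob {x \<in> space M. N - j < \<tau> 1 x})"
    by (rule member_le_sum) (auto simp: pinned_nonneg)
  finally show ?thesis by (simp add: free_eq_sum_pinned)
qed

lemma free_le_sum_pinned: "free f N \<le> (\<Sum>j\<le>N. pinned f j)"
  unfolding free_eq_sum_pinned by (rule sum_mono) (simp add: mult_left_le pinned_nonneg)

text \<open>
  For a fixed horizon only finitely many contact sets occur, which turns the expectation over the
  renewal process into a finite sum with nonnegative weights of total mass 1.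
\<close>

definition contact_set_prob :: "nat \<Rightarrow> nat set \<Rightarrow> real" where
  "contact_set_prob N A = prob {x \<in> space M. {n \<in> {1..N}. contact \<tau> n x = 1} = A}"

lemma free_eq_sum_contact_sets:
  "free f N = (\<Sum>A\<in>Pow {1..N}. contact_set_prob N A * (\<Prod>n\<in>A. exp (f n)))"
proof -
  define S where "S x = {n \<in> {1..N}. contact \<tau> n x = 1}" for x
  have meas: "{x \<in> space M. S x = A} \<in> sets M" for A
  proof -
    have "{x \<in> space M. S x = A} = {x \<in> space M. \<forall>n. n \<in> A \<longleftrightarrow> n \<in> {1..N} \<and> contact \<tau> n x = 1}"
      by (auto simp: S_def set_eq_iff)
    then show ?thesis by simp
  qed
  have "weight f N x = (\<Sum>A\<in>Pow {1..N}. indicator {x \<in> space M. S x = A} x * (\<Prod>n\<in>A. exp (f n)))"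
    if "x \<in> space M" for x
  proof -
    have "(\<Sum>n=1..N. f n * contact \<tau> n x) = (\<Sum>n\<in>{1..N}. if n \<in> S x then f n else 0)"
      by (rule sum.cong) (auto simp: S_def contact_def)
    also have "\<dots> = (\<Sum>n\<in>S x. f n)"
      by (subst sum.inter_restrict[symmetric]) (auto simp: S_def intro!: sum.cong)
    finally have "weight f N x = (\<Prod>n\<in>S x. exp (f n))"
      by (simp add: weight_def exp_sum S_def)
    also have "\<dots> = (\<Sum>A\<in>Pow {1..N}. if A = S x then (\<Prod>n\<in>A. exp (f n)) else 0)"
      by (subst sum.delta) (auto simp: S_def)
    also have "\<dots> = (\<Sum>A\<in>Pow {1..N}. indicator {x \<in> space M. S x = A} x * (\<Prod>n\<in>A. exp (f n)))"
      using that by (intro sum.cong) (auto simp: indicator_def)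
    finally show ?thesis .
  qed
  then have "free f N = expectation (\<lambda>x. \<Sum>A\<in>Pow {1..N}. indicator {x \<in> space M. S x = A} x * (\<Prod>n\<in>A. exp (f n)))"
    unfolding free_def by (intro Bochner_Integration.integral_cong) auto
  also have "\<dots> = (\<Sum>A\<in>Pow {1..N}. expectation (\<lambda>x. indicator {x \<in> space M. S x = A} x * (\<Prod>n\<in>A. exp (f n))))"
    by (rule Bochner_Integration.integral_sum)
       (use meas in \<open>auto intro!: integrable_mult_left integrable_real_indicator simp: less_top[symmetric]\<close>)
  also have "\<dots> = (\<Sum>A\<in>Pow {1..N}. contact_set_prob N A * (\<Prod>n\<in>A. exp (f n)))"
    using meas by (simp add: contact_set_prob_def S_def)
  finally show ?thesis .
qed

lemma contact_set_prob_nonneg: "0 \<le> contact_set_prob N A"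
  by (simp add: contact_set_prob_def)

lemma sum_contact_set_prob: "(\<Sum>A\<in>Pow {1..N}. contact_set_prob N A) = 1"
  using free_eq_sum_contact_sets[of "\<lambda>_. 0" N] by (simp add: free_0)

end

section \<open>Renewals with polynomial tails\<close>

text \<open>
  The form in which the tail asymptotics enter, with \<open>p = 1 + \<alpha>\<close>. Short gaps may have probability
  zero, hence the threshold.
\<close>

locale polynomial_renewal = renewal_process +
  fixes n0 :: nat and c p :: real
  assumes n0_ge: "1 \<le> n0" and c_pos: "0 < c" and p_pos: "0 < p"
    and K_ge: "\<And>n. n0 \<le> n \<Longrightarrow> c * real n powr (- p) \<le> K n"
begin

lemma pinned_ge_poly:
  assumes "n0 \<le> n" and "- b \<le> f n"
  shows "exp (- b) * (c * real n powr (- p)) \<le> pinned f n"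
proof -
  have "exp (- b) * (c * real n powr (- p)) \<le> exp (f n) * K n"
    using assms K_ge[OF assms(1)] c_pos by (intro mult_mono) auto
  also have "\<dots> \<le> pinned f n" using assms n0_ge by (intro pinned_ge_K) simp
  finally show ?thesis .
qed

lemma pinned_pos:
  assumes "n0 \<le> n"
  shows "0 < pinned f n"
proof -
  have "0 < exp (f n) * (c * real n powr (- p))"
    using assms n0_ge c_pos by simp
  also have "\<dots> \<le> pinned f n"
    using pinned_ge_poly[OF assms, of "- f n" f] by simp
  finally show ?thesis .
qed

lemma ln_pinned_bound:
  assumes "n0 \<le> n" and "\<And>n. \<bar>f n\<bar> \<le> b"
  shows "\<bar>ln (pinned f n)\<bar> \<le> (b + \<bar>ln c\<bar> + p) * real n"
proof -
  have n: "1 \<le> real n" using assms(1) n0_ge by simp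
  have b: "0 \<le> b" using assms(2)[of 0] by linarith
  have pos: "0 < pinned f n" by (rule pinned_pos[OF assms(1)])
  have "pinned f n \<le> exp (b * real n)"
    using pinned_le_free[of f n] free_le_exp[of f b n] assms(2) b by (smt (verit) abs_le_iff)
  then have "ln (pinned f n) \<le> b * real n"
    using pos by (metis ln_exp ln_le_cancel_iff exp_gt_zero)
  moreover have "b * real n \<le> (b + \<bar>ln c\<bar> + p) * real n"
    using p_pos by (intro mult_right_mono) auto
  moreover have "- ((b + \<bar>ln c\<bar> + p) * real n) \<le> ln (pinned f n)"
  proof -
    have "ln (exp (- b) * (c * real n powr (- p))) \<le> ln (pinned f n)"
      using pinned_ge_poly[of n b f] assms pos n c_pos
      by (subst ln_le_cancel_iff) (auto simp: abs_le_iff minus_le_iff)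
    moreover have "ln (exp (- b) * (c * real n powr (- p))) = - b + ln c - p * ln (real n)"
      using n c_pos by (simp add: ln_mult ln_powr)
    moreover have "p * ln (real n) \<le> p * real n"
      using p_pos n ln_bound[of "real n"] by (intro mult_left_mono) auto
    moreover have "b * 1 \<le> b * real n" "\<bar>ln c\<bar> * 1 \<le> \<bar>ln c\<bar> * real n"
      using b n by (intro mult_left_mono; simp)+
    ultimately show ?thesis by (simp add: algebra_simps)
  qed
  ultimately show ?thesis by linarith
qed

text \<open>
  From its last contact \<open>j \<le> N\<close> a trajectory is forced to jump to \<open>N + n0\<close>. The price is polynomial, and
  the additional \<open>n0\<close> steps make every such jump long enough for the lower bound on \<open>K\<close>.
\<close>

lemma free_le_poly_pinned:
  assumes "\<And>n. - b \<le> f n"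
  shows "free f N \<le> real (N + 1) * (exp b / c * real (N + n0) powr p) * pinned f (N + n0)"
proof -
  have "pinned f j \<le> exp b / c * real (N + n0) powr p * pinned f (N + n0)" if "j \<le> N" for j
  proof -
    have "exp (- b) * (pinned f j * (c * real (N + n0) powr (- p))) \<le> exp (f (N + n0)) * (pinned f j * K (N + n0 - j))"
    proof (intro mult_mono)
      have "c * real (N + n0) powr (- p) \<le> c * real (N + n0 - j) powr (- p)"
        using that c_pos p_pos n0_ge by (intro mult_left_mono powr_mono2') auto
      also have "\<dots> \<le> K (N + n0 - j)" using that by (intro K_ge) simp
      finally show "c * real (N + n0) powr (- p) \<le> K (N + n0 - j)" .
    qed (use assms c_pos in \<open>auto simp: pinned_nonneg\<close>)
    also have "\<dots> \<le> pinned f (N + n0)"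
      using that n0_ge by (intro pinned_step_ge) simp
    finally have "exp (- b) * (pinned f j * (c * real (N + n0) powr (- p))) \<le> pinned f (N + n0)" .
    moreover have "0 < real (N + n0) powr p" using n0_ge by simp
    ultimately show ?thesis using c_pos by (simp add: exp_minus powr_minus field_simps)
  qed
  then have "(\<Sum>j\<le>N. pinned f j) \<le> (\<Sum>j\<le>N. exp b / c * real (N + n0) powr p * pinned f (N + n0))"
    by (intro sum_mono) auto
  then show ?thesis using free_le_sum_pinned[of f N] by (simp add: mult_ac)
qed

lemma ln_free_limit:
  assumes b: "\<And>n. - b \<le> f n" and lim: "(\<lambda>n. ln (pinned f n) / real n) \<longlonglongrightarrow> \<gamma>"
  shows "(\<lambda>n. ln (free f n) / real n) \<longlonglongrightarrow> \<gamma>"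
proof (rule tendsto_sandwich)
  define err where "err N = ln (real (N + 1) * (exp b / c * real (N + n0) powr p)) / real N" for N
  show "\<forall>\<^sub>F n in sequentially. ln (pinned f n) / real n \<le> ln (free f n) / real n"
    using eventually_ge_at_top[of n0]
  proof eventually_elim
    case (elim n)
    then show ?case
      using pinned_pos[OF elim, of f] pinned_le_free[of f n] free_pos[of f n]
      by (intro divide_right_mono) (auto simp: ln_le_cancel_iff)
  qed
  show "\<forall>\<^sub>F n in sequentially. ln (free f n) / real n \<le>
      err n + ln (pinned f (n + n0)) / real (n + n0) * (real (n + n0) / real n)"
    using eventually_gt_at_top[of 0]
  proof eventually_elim
    case (elim n)
    have pos: "0 < pinned f (n + n0)" by (rule pinned_pos) simp
    have pos2: "0 < real (n + 1) * (exp b / c * real (n + n0) powr p)" using c_pos elim by simp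
    have "ln (free f n) \<le> ln (real (n + 1) * (exp b / c * real (n + n0) powr p) * pinned f (n + n0))"
      using free_le_poly_pinned[of b f n, OF b] pos pos2 free_pos[of f n]
      by (subst ln_le_cancel_iff) (auto intro: mult_pos_pos)
    also have "\<dots> = ln (real (n + 1) * (exp b / c * real (n + n0) powr p)) + ln (pinned f (n + n0))"
      using pos pos2 by (intro ln_mult_pos)
    finally show ?case
      using elim unfolding err_def by (simp add: add_divide_distrib[symmetric] divide_right_mono)
  qed
  show "(\<lambda>n. ln (pinned f n) / real n) \<longlonglongrightarrow> \<gamma>" by fact
  have "err \<longlonglongrightarrow> 0"
    using c_pos p_pos n0_ge unfolding err_def by real_asymp
  moreover have "(\<lambda>n. ln (pinned f (n + n0)) / real (n + n0)) \<longlonglongrightarrow> \<gamma>"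
    using LIMSEQ_ignore_initial_segment[OF lim, of n0] by simp
  moreover have "(\<lambda>n. real (n + n0) / real n) \<longlonglongrightarrow> 1" by real_asymp
  ultimately have "(\<lambda>n. err n + ln (pinned f (n + n0)) / real (n + n0) * (real (n + n0) / real n)) \<longlonglongrightarrow> 0 + \<gamma> * 1"
    by (intro tendsto_intros)
  then show "(\<lambda>n. err n + ln (pinned f (n + n0)) / real (n + n0) * (real (n + n0) / real n)) \<longlonglongrightarrow> \<gamma>" by simp
qed

text \<open>
  A homogeneous reward \<open>h > 0\<close> localizes a recurrent renewal. Already the gaps below some \<open>m\<close> have
  total mass \<open>s > 1\<close> after multiplication by \<open>exp h\<close>. Discounting a gap \<open>i\<close> by \<open>exp (- F * i)\<close> with
  \<open>F = ln s / m\<close> leaves mass at least 1, so the discounted partition function never falls below its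
  minimum over \<open>m\<close> consecutive lengths.
\<close>

lemma homogeneous_growth:
  assumes "0 < h"
  obtains F c0 where "0 < F" "0 < c0" "\<And>l. n0 \<le> l \<Longrightarrow> c0 * exp (F * real l) \<le> pinned (\<lambda>_. h) l"
proof -
  have "(\<lambda>n. \<Sum>i<n. K i) \<longlonglongrightarrow> 1" using K_sums_1 by (simp add: sums_def)
  then have "\<forall>\<^sub>F n in sequentially. exp (- h) < (\<Sum>i<n. K i)"
    using assms by (intro order_tendstoD(1)) auto
  moreover have "\<forall>\<^sub>F n in sequentially. 2 \<le> n" by (rule eventually_ge_at_top)
  ultimately obtain m where m: "exp (- h) < (\<Sum>i<m. K i)" "2 \<le> m"
    by (metis (mono_tags, lifting) eventually_conj eventually_sequentially order_refl)
  define s where "s = exp h * (\<Sum>i<m. K i)"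
  have "exp h * exp (- h) < s" unfolding s_def using m(1) by (intro mult_strict_left_mono) auto
  then have s: "1 < s" by (simp add: exp_minus)
  define F where "F = ln s / real m"
  have F: "0 < F" using s m(2) by (simp add: F_def)
  have Fm: "exp (F * real m) = s" using s m(2) by (simp add: F_def)
  define v where "v l = pinned (\<lambda>_. h) l * exp (- F * real l)" for l
  define c0 where "c0 = Min (v ` {n0..<n0 + m})"
  have c0: "0 < c0"
    unfolding c0_def using m(2) by (subst Min_gr_iff) (auto simp: v_def pinned_pos)
  have v_ge: "c0 \<le> v l" if "n0 \<le> l" for l
    using that
  proof (induction l rule: less_induct)
    case (less l)
    show ?case
    proof (cases "l < n0 + m")
      case True
      then show ?thesis unfolding c0_def using less.prems by (intro Min_le) auto
    next
      case False
      obtain l' where l': "l = Suc l'" using False m(2) by (cases l) auto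
      have "c0 * exp (F * real l) * (\<Sum>i<m. K i) * exp (- F * real m)
          \<le> (\<Sum>i\<in>{1..<m}. K i * pinned (\<lambda>_. h) (l - i))"
      proof -
        have "c0 * exp (F * real l) * (\<Sum>i<m. K i) * exp (- F * real m)
            = (\<Sum>i<m. K i * (c0 * exp (F * (real l - real m))))"
          by (simp add: sum_distrib_left sum_distrib_right mult_ac exp_diff exp_minus field_simps)
        also have "\<dots> = (\<Sum>i\<in>{1..<m}. K i * (c0 * exp (F * (real l - real m))))"
          by (rule sum.mono_neutral_right) (auto simp: K_0 not_le intro: Suc_leI)
        also have "\<dots> \<le> (\<Sum>i\<in>{1..<m}. K i * pinned (\<lambda>_. h) (l - i))"
        proof (intro sum_mono mult_left_mono K_nonneg)
          fix i assume i: "i \<in> {1..<m}"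
          have "c0 * exp (F * (real l - real m)) \<le> c0 * exp (F * real (l - i))"
            using i False F c0 by (intro mult_left_mono) auto
          also have "\<dots> \<le> v (l - i) * exp (F * real (l - i))"
            using i False by (intro mult_right_mono less.IH) auto
          also have "\<dots> = pinned (\<lambda>_. h) (l - i)" by (simp add: v_def exp_minus)
          finally show "c0 * exp (F * (real l - real m)) \<le> pinned (\<lambda>_. h) (l - i)" .
        qed
        finally show ?thesis .
      qed
      also have "\<dots> = (\<Sum>j\<in>(\<lambda>i. l - i) ` {1..<m}. pinned (\<lambda>_. h) j * K (l - j))"
        using False by (subst sum.reindex) (auto simp: inj_on_def mult.commute intro!: sum.cong)
      also have "\<dots> \<le> (\<Sum>j\<le>l'. pinned (\<lambda>_. h) j * K (Suc l' - j))"
        unfolding l' by (rule sum_mono2) (auto simp: K_nonneg pinned_nonneg)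
      finally have "exp h * (c0 * exp (F * real l) * (\<Sum>i<m. K i) * exp (- F * real m)) \<le> pinned (\<lambda>_. h) l"
        by (simp add: l' pinned_Suc)
      moreover have "exp h * (c0 * exp (F * real l) * (\<Sum>i<m. K i) * exp (- F * real m)) = c0 * exp (F * real l)"
      proof -
        have "exp h * (c0 * exp (F * real l) * (\<Sum>i<m. K i) * exp (- F * real m))
            = c0 * exp (F * real l) * (s * exp (- F * real m))" by (simp add: s_def mult_ac)
        also have "s * exp (- F * real m) = 1" using Fm s by (simp add: exp_minus)
        finally show ?thesis by simp
      qed
      ultimately have "c0 * exp (F * real l) \<le> pinned (\<lambda>_. h) l" by linarith
      then show ?thesis by (simp add: v_def exp_minus field_simps)
    qed
  qed
  show thesis
  proof (rule that[OF F c0])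
    fix l assume "n0 \<le> l"
    then show "c0 * exp (F * real l) \<le> pinned (\<lambda>_. h) l"
      using v_ge[of l] by (simp add: v_def exp_minus field_simps)
  qed
qed

text \<open>
  The tangent of the logarithm at \<open>D\<close>: a jump costs at most as much as one of length \<open>D\<close> together with an
  amount linear in its length. The linear part adds up over successive jumps to at most \<open>p / D\<close> times
  the total length.
\<close>

lemma powr_tangent_bound:
  assumes "0 < D" and "1 \<le> n"
  shows "D powr (- p) * exp (- (p / D) * real n) \<le> real n powr (- p)"
proof -
  have "ln (real n / D) \<le> real n / D - 1"
    using assms by (intro ln_le_minus_one) auto
  then have "ln (real n) \<le> ln D + real n / D" using assms by (simp add: ln_div)
  then have "p * ln (real n) \<le> p * (ln D + real n / D)" using p_pos by (intro mult_left_mono) auto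
  then have "- p * ln D - (p / D) * real n \<le> - p * ln (real n)" by (simp add: algebra_simps)
  then have "exp (- p * ln D - (p / D) * real n) \<le> exp (- p * ln (real n))" by simp
  then show ?thesis using assms by (simp add: powr_def mult_exp_exp)
qed

text \<open>
  A trajectory that repeatedly jumps to the first start \<open>k\<close> of a stretch of length \<open>l\<close> worth \<open>V\<close>
  (marked by \<open>G\<close>) at distance at least \<open>n0\<close>, and collects \<open>V\<close> there. One round passes at most \<open>n0 + l\<close>
  marked starts, namely those closer than \<open>n0\<close> and those inside the stretch; by \<open>key\<close>, after the price
  \<open>D powr (- p)\<close> of the jump there remains a factor \<open>exp \<kappa>\<close> for each of them. The last jump to \<open>N\<close> may miss
  \<open>2 * n0 + l\<close> more marked starts.
\<close>

lemma pinned_lower_bound_by_good_stretches: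
  assumes D: "0 < D" and "0 \<le> \<kappa>"
    and key: "exp (\<kappa> * real (n0 + l)) \<le> exp (- b) * c * D powr (- p) * V"
    and f: "\<And>n. - b \<le> f n"
    and good: "\<And>k. G k \<Longrightarrow> V \<le> pinned (\<lambda>i. f (k + i)) l"
    and "n0 \<le> N"
  shows "exp (- b) * c * D powr (- p) * exp (- \<kappa> * real (2 * n0 + l))
      * exp (\<kappa> * (\<Sum>k<N. of_bool (G k)) - (p / D) * real N) \<le> pinned f N"
  using f good \<open>n0 \<le> N\<close>
proof (induction N arbitrary: f G rule: less_induct)
  case (less N f G)
  define A where "A = exp (- b) * c * D powr (- p)"
  have A: "0 < A" using c_pos D by (simp add: A_def)
  have jump: "A * exp (- (p / D) * real n) \<le> pinned f n" if "n0 \<le> n" for n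
  proof -
    have "A * exp (- (p / D) * real n) \<le> exp (- b) * (c * real n powr (- p))"
      unfolding A_def mult.assoc
      using that n0_ge c_pos D by (intro mult_left_mono powr_tangent_bound) auto
    also have "\<dots> \<le> pinned f n" by (rule pinned_ge_poly[OF that less.prems(1)])
    finally show ?thesis .
  qed
  show ?case
  proof (cases "\<exists>k. n0 \<le> k \<and> k + l + n0 \<le> N \<and> G k")
    case False
    have "(\<Sum>k<N. of_bool (G k) :: real) \<le> (\<Sum>k\<in>{..<n0} \<union> {N - l - n0..<N}. 1)"
    proof (rule order_trans[OF eq_refl sum_mono2])
      have "(\<Sum>k<N. of_bool (G k) :: real) = (\<Sum>k\<in>{k. k < N \<and> G k}. 1)"
        by (simp add: Int_def)
      then show "(\<Sum>k<N. of_bool (G k) :: real) = (\<Sum>k\<in>{k. k < N \<and> G k}. 1)" .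
      show "{k. k < N \<and> G k} \<subseteq> {..<n0} \<union> {N - l - n0..<N}"
        using False by (auto simp: not_le not_less)
    qed auto
    also have "\<dots> \<le> real (2 * n0 + l)"
    proof -
      have "card ({..<n0} \<union> {N - l - n0..<N}) \<le> card {..<n0} + card {N - l - n0..<N}"
        by (rule card_Un_le)
      also have "\<dots> \<le> 2 * n0 + l" by simp
      finally show ?thesis by simp
    qed
    finally have "\<kappa> * (\<Sum>k<N. of_bool (G k)) \<le> \<kappa> * real (2 * n0 + l)"
      using \<open>0 \<le> \<kappa>\<close> by (rule mult_left_mono)
    then have "exp (- \<kappa> * real (2 * n0 + l)) * exp (\<kappa> * (\<Sum>k<N. of_bool (G k)) - (p / D) * real N)
        \<le> exp (- (p / D) * real N)"
      by (simp add: exp_add[symmetric])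
    then have "A * (exp (- \<kappa> * real (2 * n0 + l)) * exp (\<kappa> * (\<Sum>k<N. of_bool (G k)) - (p / D) * real N))
        \<le> A * exp (- (p / D) * real N)"
      using A by (intro mult_left_mono) auto
    also have "\<dots> \<le> pinned f N" by (rule jump[OF less.prems(3)])
    finally show ?thesis by (simp add: A_def mult.assoc)
  next
    case True
    define k where "k = (LEAST k. n0 \<le> k \<and> k + l + n0 \<le> N \<and> G k)"
    have k: "n0 \<le> k" "k + l + n0 \<le> N" "G k"
      using LeastI_ex[OF True] by (auto simp: k_def)
    have first: "\<not> G j" if "n0 \<le> j" "j < k" for j
      using not_less_Least[of j "\<lambda>k. n0 \<le> k \<and> k + l + n0 \<le> N \<and> G k"] that k by (auto simp: k_def)
    define r where "r = N - (k + l)"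
    have r: "n0 \<le> r" "N = k + l + r" "r < N" using k n0_ge by (auto simp: r_def)
    define S where "S = (\<Sum>j<r. of_bool (G (k + l + j)) :: real)"
    have "(\<Sum>j<N. of_bool (G j) :: real) = (\<Sum>j<k + l. of_bool (G j)) + S"
      unfolding S_def r(2) by (induction r) (simp_all add: add.assoc)
    also have "(\<Sum>j<k + l. of_bool (G j) :: real) \<le> real (n0 + l)"
    proof -
      have "(\<Sum>j<k + l. of_bool (G j) :: real) = real (card {j. j < k + l \<and> G j})"
        by (simp add: Int_def)
      also have "card {j. j < k + l \<and> G j} \<le> card ({..<n0} \<union> {k..<k + l})"
        using first by (intro card_mono) (auto simp: not_less, metis not_le)
      also have "\<dots> \<le> n0 + l"
        using card_Un_le[of "{..<n0}" "{k..<k + l}"] by simp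
      finally show ?thesis by simp
    qed
    finally have count: "(\<Sum>j<N. of_bool (G j) :: real) \<le> real (n0 + l) + S" by simp
    define B where "B = exp (- \<kappa> * real (2 * n0 + l))"
    have "A * B * exp (\<kappa> * (\<Sum>j<N. of_bool (G j)) - (p / D) * real N)
        \<le> A * B * exp (\<kappa> * (real (n0 + l) + S) - (p / D) * (real k + real r))"
    proof (intro mult_left_mono)
      have "(p / D) * (real k + real r) \<le> (p / D) * real N"
        using p_pos D by (intro mult_left_mono) (auto simp: r(2))
      moreover have "\<kappa> * (\<Sum>j<N. of_bool (G j)) \<le> \<kappa> * (real (n0 + l) + S)"
        using count \<open>0 \<le> \<kappa>\<close> by (rule mult_left_mono)
      ultimately show "exp (\<kappa> * (\<Sum>j<N. of_bool (G j)) - (p / D) * real N)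
        \<le> exp (\<kappa> * (real (n0 + l) + S) - (p / D) * (real k + real r))" by simp
    qed (use A in \<open>auto simp: B_def\<close>)
    also have "\<dots> = exp (- (p / D) * real k) * exp (\<kappa> * real (n0 + l)) * (A * B * exp (\<kappa> * S - (p / D) * real r))"
    proof -
      have "\<kappa> * (real (n0 + l) + S) - (p / D) * (real k + real r)
          = - (p / D) * real k + \<kappa> * real (n0 + l) + (\<kappa> * S - (p / D) * real r)"
        by (simp add: algebra_simps)
      then show ?thesis by (simp only: exp_add mult_ac)
    qed
    also have "\<dots> \<le> exp (- (p / D) * real k) * (A * V) * (A * B * exp (\<kappa> * S - (p / D) * real r))"
      using key A by (intro mult_right_mono mult_left_mono) (auto simp: A_def B_def)
    also have "\<dots> = (A * exp (- (p / D) * real k)) * V * (A * B * exp (\<kappa> * S - (p / D) * real r))"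
      by (simp add: mult_ac)
    also have "\<dots> \<le> pinned f k * pinned (\<lambda>i. f (k + i)) l * pinned (\<lambda>i. f (k + l + i)) r"
    proof (intro mult_mono)
      show "A * exp (- (p / D) * real k) \<le> pinned f k" by (rule jump[OF k(1)])
      show "V \<le> pinned (\<lambda>i. f (k + i)) l" using less.prems(2) k(3) .
      show "A * B * exp (\<kappa> * S - (p / D) * real r) \<le> pinned (\<lambda>i. f (k + l + i)) r"
        unfolding A_def B_def S_def
      proof (rule less.IH[OF r(3) _ _ r(1)])
        show "- b \<le> f (k + l + n)" for n by (rule less.prems(1))
        show "V \<le> pinned (\<lambda>i. f (k + l + (j + i))) l" if "G (k + l + j)" for j
          using less.prems(2)[OF that] by (simp add: add.assoc)
      qed
      show "0 \<le> V" 
      proof -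
        have "0 < A * V" using key exp_gt_zero[of "\<kappa> * real (n0 + l)"] unfolding A_def by linarith
        then show ?thesis using A by (simp add: zero_less_mult_iff)
      qed
    qed (use A in \<open>auto simp: pinned_nonneg B_def\<close>)
    also have "\<dots> \<le> pinned f (k + l) * pinned (\<lambda>i. f (k + l + i)) r"
      by (intro mult_right_mono pinned_superadditive pinned_nonneg)
    also have "\<dots> \<le> pinned f N"
      unfolding r(2) by (rule pinned_superadditive)
    finally show ?thesis by (simp add: A_def B_def mult.assoc)
  qed
qed

end

section \<open>The law of the environment\<close>

lemma seq_shift_iterate: "(seq_shift ^^ k) w = (\<lambda>i. w (i + k))"
  by (induction k arbitrary: w) (simp_all add: seq_shift_def funpow_swap1 add.commute)

lemma (in prob_space) AE_witness:
  assumes "AE x in M. Q x"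
  obtains x where "x \<in> space M" "Q x"
proof (rule ccontr)
  assume "\<not> thesis"
  then have "\<not> Q x" if "x \<in> space M" for x using that \<open>\<And>x. x \<in> space M \<Longrightarrow> Q x \<Longrightarrow> thesis\<close> by blast
  then have "AE x in M. False" using assms by (auto elim!: AE_mp)
  then show False by simp
qed

context sign_environment
begin

abbreviation law :: "(nat \<Rightarrow> real) measure" where
  "law \<equiv> distr P sequence_space (\<lambda>y i. \<omega> i y)"

lemma measurable_env' [measurable]: "\<omega> i \<in> borel_measurable P"
  by (rule measurable_env)

lemma path_measurable [measurable]: "(\<lambda>y i. \<omega> i y) \<in> measurable P sequence_space"
  by (rule measurable_PiM_single') (auto simp: PiE_UNIV_domain)

lemma seq_shift_measurable: "seq_shift \<in> measurable sequence_space sequence_space"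
  unfolding seq_shift_def[abs_def]
  by (rule measurable_PiM_single') (auto simp: PiE_UNIV_domain intro: measurable_component_singleton)

sublocale law: ergodic_map law seq_shift
proof -
  interpret L: prob_space law by (rule prob_space_distr) measurable
  have sp: "space law = UNIV" by (simp add: space_PiM PiE_UNIV_domain)
  show "ergodic_map law seq_shift"
  proof
    show "seq_shift \<in> measurable law law"
      using seq_shift_measurable by (simp add: measurable_distr_eq1 measurable_distr_eq2)
    have "distr law law seq_shift = distr law sequence_space seq_shift"
      by (rule distr_cong) auto
    also have "\<dots> = law"
      using stationary_env by (simp add: stationary_law_def)
    finally show "distr law law seq_shift = law" .
    show "measure law A = 0 \<or> measure law A = 1"
      if "A \<in> sets law" "seq_shift -` A \<inter> space law = A" for A
      using ergodic_env that unfolding ergodic_law_def sp by simp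
  qed
qed

lemma AE_law: "AE w in law. Q w \<Longrightarrow> AE y in P. Q (\<lambda>i. \<omega> i y)"
  by (rule AE_distrD[OF path_measurable])

definition plus_on :: "nat set \<Rightarrow> (nat \<Rightarrow> real) set" where
  "plus_on E = {w. \<forall>i\<in>E. w i = 1}"

lemma plus_on_sets [measurable]: "plus_on E \<in> sets law"
proof -
  have "plus_on E = {w \<in> space sequence_space. \<forall>i\<in>E. w i = 1}"
    by (auto simp: plus_on_def space_PiM PiE_UNIV_domain)
  also have "\<dots> \<in> sets sequence_space"
  proof -
    have [measurable]: "(\<lambda>w. w i) \<in> borel_measurable sequence_space" for i
      by (rule measurable_component_singleton) simp
    show ?thesis by measurable
  qed
  finally show ?thesis by simp
qed

lemma all_plus_sets [measurable]: "all_plus P \<omega> E \<in> sets P"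
proof -
  have "all_plus P \<omega> E = (\<lambda>y i. \<omega> i y) -` plus_on E \<inter> space P"
    by (auto simp: all_plus_def plus_on_def)
  also have "\<dots> \<in> sets P"
    by (rule measurable_sets[OF path_measurable]) (use plus_on_sets in simp)
  finally show ?thesis .
qed

lemma prob_all_plus: "prob (all_plus P \<omega> E) = measure law (plus_on E)"
proof -
  have "measure law (plus_on E) = prob ((\<lambda>y i. \<omega> i y) -` plus_on E \<inter> space P)"
    by (rule measure_distr[OF path_measurable]) (use plus_on_sets in simp)
  also have "(\<lambda>y i. \<omega> i y) -` plus_on E \<inter> space P = all_plus P \<omega> E"
    by (auto simp: all_plus_def plus_on_def)
  finally show ?thesis by simp
qed

lemma prob_all_plus_shift: "prob (all_plus P \<omega> ((\<lambda>i. i + k) ` E)) = prob (all_plus P \<omega> E)"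
proof -
  have "(seq_shift ^^ k) -` plus_on E \<inter> space law = plus_on ((\<lambda>i. i + k) ` E)"
    by (auto simp: plus_on_def seq_shift_iterate space_PiM PiE_UNIV_domain)
  then show ?thesis
    using law.prob_iterate[OF plus_on_sets, of k E] by (simp add: prob_all_plus)
qed

lemma prob_all_plus_contract_gap:
  assumes corr: "nonincreasing_correlations P \<omega>"
    and E: "finite E1" "finite E2" "E1 \<noteq> {}" "E2 \<noteq> {}" "E1 \<subseteq> {1..}" "E2 \<subseteq> {1..}" "Max E1 < Min E2"
  shows "prob (all_plus P \<omega> (E1 \<union> (\<lambda>i. i + k) ` E2)) \<le> prob (all_plus P \<omega> (E1 \<union> E2))"
proof (induction k)
  case 0
  then show ?case by simp
next
  case (Suc k)
  have "prob (all_plus P \<omega> (E1 \<union> (\<lambda>i. i + (k + 1)) ` E2))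
      \<le> prob (all_plus P \<omega> (E1 \<union> (\<lambda>i. i + k) ` E2))"
    using corr E unfolding nonincreasing_correlations_def by blast
  then show ?case using Suc by simp
qed

text \<open>
  Closing the gap between the interval \<open>{a..<a + m}\<close> and \<open>E\<close> does not decrease the probability; the
  interval then absorbs the least element of the translated \<open>E\<close>. Once \<open>E\<close> is used up, stationarity moves
  the interval to \<open>{1..}\<close>.
\<close>

lemma prob_all_plus_contract:
  assumes corr: "nonincreasing_correlations P \<omega>"
    and "1 \<le> a" "1 \<le> m" "finite E" "\<And>i. i \<in> E \<Longrightarrow> a + m \<le> i"
  shows "prob (all_plus P \<omega> ({a..<a + m} \<union> E)) \<le> prob (all_plus P \<omega> {1..m + card E})"
  using assms(3-)
proof (induction "card E" arbitrary: m E)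
  case 0
  have "{a..<a + m} = (\<lambda>i. i + (a - 1)) ` {1..m}"
  proof -
    have "i \<in> (\<lambda>i. i + (a - 1)) ` {1..m}" if "i \<in> {a..<a + m}" for i
      using that \<open>1 \<le> a\<close> by (intro image_eqI[of _ _ "i - (a - 1)"]) auto
    then show ?thesis using \<open>1 \<le> a\<close> by auto
  qed
  moreover have "E = {}" using 0 by simp
  ultimately show ?case using prob_all_plus_shift[of "a - 1" "{1..m}"] by simp
next
  case (Suc n)
  have ne: "E \<noteq> {}" using Suc.hyps(2) by auto
  define k where "k = Min E - (a + m)"
  define E' where "E' = (\<lambda>i. i - k) ` E"
  have k: "k + (a + m) = Min E"
    using Suc.prems Min_in[OF Suc.prems(2) ne] by (auto simp: k_def)
  have le: "k + (a + m) \<le> i" if "i \<in> E" for i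
    unfolding k using that Suc.prems(2) by simp
  have "(\<lambda>i. i + k) ` E' = (\<lambda>i. i) ` E"
    unfolding E'_def image_image by (rule image_cong[OF refl]) (use le in force)
  then have E_eq: "E = (\<lambda>i. i + k) ` E'" by simp
  have inj: "inj_on (\<lambda>i. i - k) E"
    by (rule inj_onI) (use le in \<open>metis add_leD1 eq_diff_iff\<close>)
  have fin': "finite E'" and card': "card E' = Suc n"
    using Suc.prems(2) Suc.hyps(2) inj by (auto simp: E'_def card_image)
  have in': "a + m \<in> E'"
    using Min_in[OF Suc.prems(2) ne] unfolding E'_def k[symmetric] by (intro image_eqI) auto
  have le': "a + m \<le> i" if "i \<in> E'" for i
  proof -
    from that have "\<exists>i'\<in>E. i = i' - k" by (auto simp: E'_def)
    then obtain i' where "i' \<in> E" "i = i' - k" by blast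
    then show ?thesis using le[of i'] by simp
  qed
  have Min': "Min E' = a + m"
    using fin' in' le' by (intro Min_eqI) auto
  have "prob (all_plus P \<omega> ({a..<a + m} \<union> (\<lambda>i. i + k) ` E')) \<le> prob (all_plus P \<omega> ({a..<a + m} \<union> E'))"
  proof (rule prob_all_plus_contract_gap[OF corr])
    have "Max {a..<a + m} < a + m"
      using \<open>1 \<le> m\<close> by (subst Max_less_iff) auto
    then show "Max {a..<a + m} < Min E'" by (simp add: Min')
    show "E' \<subseteq> {1..}" using le' \<open>1 \<le> a\<close> by force
    show "{a..<a + m} \<subseteq> {1..}" using \<open>1 \<le> a\<close> by auto
    show "{a..<a + m} \<noteq> {}" using \<open>1 \<le> m\<close> by simp
  qed (use fin' in' in auto)
  also have "{a..<a + m} \<union> E' = {a..<a + Suc m} \<union> (E' - {a + m})"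
    using in' by (auto simp: less_Suc_eq)
  also have "prob (all_plus P \<omega> \<dots>) \<le> prob (all_plus P \<omega> {1..Suc m + card (E' - {a + m})})"
  proof (rule Suc.hyps(1))
    show "n = card (E' - {a + m})" using card' in' by simp
    show "a + Suc m \<le> i" if "i \<in> E' - {a + m}" for i
      using that le'[of i] by auto
  qed (use fin' in auto)
  also have "Suc m + card (E' - {a + m}) = m + card E"
    using card' in' fin' Suc.hyps(2) by simp
  finally show ?case using E_eq by simp
qed

lemma prob_all_plus_le_block:
  assumes corr: "nonincreasing_correlations P \<omega>" and "finite A" "A \<subseteq> {1..}"
  shows "prob (all_plus P \<omega> A) \<le> prob (all_plus P \<omega> {1..card A})"
proof (cases "A = {}")
  case True
  then show ?thesis by simp
next
  case False
  define a where "a = Min A"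
  have a: "a \<in> A" "\<And>i. i \<in> A \<Longrightarrow> a \<le> i" using False assms(2) by (auto simp: a_def)
  have "A = {a..<a + 1} \<union> (A - {a})" using a(1) by auto
  moreover have "prob (all_plus P \<omega> ({a..<a + 1} \<union> (A - {a}))) \<le> prob (all_plus P \<omega> {1..1 + card (A - {a})})"
    using a assms by (intro prob_all_plus_contract[OF corr]) (auto intro: Suc_leI le_neq_implies_less)
  moreover have "1 + card (A - {a}) = card A"
    using a(1) assms(2) by (metis card_Suc_Diff1 plus_1_eq_Suc)
  ultimately show ?thesis by simp
qed

lemma plus_stretch_rate_nonneg: "0 \<le> plus_stretch_rate P \<omega>"
  unfolding plus_stretch_rate_def
proof (rule Liminf_bounded, rule always_eventually, rule allI)
  fix n
  have "- (1 / real n) * ln (prob (all_plus P \<omega> {1..n})) \<ge> 0"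
    if "prob (all_plus P \<omega> {1..n}) \<noteq> 0"
    using that by (intro mult_nonpos_nonpos) (auto simp: ln_le_zero_iff zero_less_measure_iff)
  then show "0 \<le> ereal (- (1 / real n)) * log_prob (prob (all_plus P \<omega> {1..n}))"
    by (auto simp: log_prob_def)
qed

lemma all_plus_exponential_decay:
  assumes "0 < plus_stretch_rate P \<omega>"
  obtains s C where "0 < s" "s < 1" "\<And>n. prob (all_plus P \<omega> {1..n}) \<le> C * s ^ n"
proof -
  obtain r where r: "0 < ereal r" "ereal r < plus_stretch_rate P \<omega>"
    using ereal_dense2[OF assms] by blast
  have "\<forall>\<^sub>F n in sequentially. ereal r < ereal (- (1 / real n)) * log_prob (prob (all_plus P \<omega> {1..n}))"
    using less_LiminfD r(2) unfolding plus_stretch_rate_def by blast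
  then obtain m where m: "\<And>n. m \<le> n \<Longrightarrow>
      ereal r < ereal (- (1 / real n)) * log_prob (prob (all_plus P \<omega> {1..n}))"
    unfolding eventually_sequentially by blast
  define s where "s = exp (- r)"
  have s: "0 < s" "s < 1" using r(1) by (auto simp: s_def)
  have s_pow: "s ^ n = exp (- r * real n)" for n
    by (simp add: s_def exp_of_nat2_mult[symmetric])
  have bound: "prob (all_plus P \<omega> {1..n}) \<le> s ^ n" if "m \<le> n" "1 \<le> n" for n
  proof (cases "prob (all_plus P \<omega> {1..n}) = 0")
    case True
    then show ?thesis using s by simp
  next
    case False
    then have pos: "0 < prob (all_plus P \<omega> {1..n})" by (simp add: zero_less_measure_iff)
    have "r < - (1 / real n) * ln (prob (all_plus P \<omega> {1..n}))"
      using m[OF that(1)] False by (simp add: log_prob_def)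
    then have "ln (prob (all_plus P \<omega> {1..n})) \<le> - r * real n"
      using that(2) by (simp add: field_simps)
    then have "prob (all_plus P \<omega> {1..n}) \<le> exp (- r * real n)"
      using pos by (metis exp_ln exp_le_cancel_iff)
    then show ?thesis by (simp add: s_pow)
  qed
  show thesis
  proof (rule that[OF s])
    \<comment> \<open>The constant makes the bound trivial for \<open>n \<le> m\<close>, where the rate gives no information.\<close>
    fix n
    show "prob (all_plus P \<omega> {1..n}) \<le> 1 / s ^ Suc m * s ^ n"
    proof (cases "Suc m \<le> n")
      case True
      have "s ^ n \<le> 1 / s ^ Suc m * s ^ n"
        using s power_le_one[of s "Suc m"] by (simp add: field_simps mult_left_le)
      then show ?thesis using bound[of n] True by simp
    next
      case False
      then have "s ^ Suc m \<le> s ^ n" using s by (intro power_decreasing) auto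
      then have "1 \<le> 1 / s ^ Suc m * s ^ n" using s by (simp add: field_simps)
      then show ?thesis using prob_le_1[of "all_plus P \<omega> {1..n}"] by linarith
    qed
  qed
qed

text \<open>
  Each factor takes the value \<open>exp (h - \<beta>)\<close> plus, at a plus site, the difference
  \<open>exp (h + \<beta>) - exp (h - \<beta>)\<close>. Expanding the product expresses the expectation with nonnegative
  coefficients through the probabilities that subsets of \<open>A\<close> are all plus; bounding these by
  \<open>C * s ^ n\<close> recombines the expansion into a power, as if the sites were independent with plus
  probability \<open>s\<close>.
\<close>

lemma expectation_boltzmann_le:
  assumes corr: "nonincreasing_correlations P \<omega>"
    and decay: "\<And>n. prob (all_plus P \<omega> {1..n}) \<le> C * s ^ n"
    and "0 \<le> s" "0 \<le> \<beta>" and A: "finite A" "A \<subseteq> {1..}"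
  shows "expectation (\<lambda>y. \<Prod>n\<in>A. exp (h + \<beta> * \<omega> n y))
    \<le> C * ((exp (h + \<beta>) - exp (h - \<beta>)) * s + exp (h - \<beta>)) ^ card A"
proof -
  define a where "a = exp (h + \<beta>) - exp (h - \<beta>)"
  define b where "b = exp (h - \<beta>)"
  have a: "0 \<le> a" and b: "0 \<le> b" using \<open>0 \<le> \<beta>\<close> by (auto simp: a_def b_def)
  have expand: "(\<Prod>n\<in>A. exp (h + \<beta> * \<omega> n y))
      = (\<Sum>X\<in>Pow A. indicator (all_plus P \<omega> X) y * (a ^ card X * b ^ card (A - X)))" if y: "y \<in> space P" for y
  proof -
    have "exp (h + \<beta> * \<omega> n y) = a * of_bool (\<omega> n y = 1) + b" for n
      using env_values[OF y, of n] by (auto simp: a_def b_def)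
    then have "(\<Prod>n\<in>A. exp (h + \<beta> * \<omega> n y)) = (\<Prod>n\<in>A. a * of_bool (\<omega> n y = 1) + b)"
      by simp
    also have "\<dots> = (\<Sum>X\<in>Pow A. (\<Prod>n\<in>X. a * of_bool (\<omega> n y = 1)) * (\<Prod>n\<in>A - X. b))"
      by (rule prod_add[OF A(1)])
    also have "\<dots> = (\<Sum>X\<in>Pow A. indicator (all_plus P \<omega> X) y * (a ^ card X * b ^ card (A - X)))"
    proof (rule sum.cong[OF refl])
      fix X assume "X \<in> Pow A"
      then have fin: "finite X" using A(1) finite_subset by blast
      have "(\<Prod>n\<in>X. of_bool (\<omega> n y = 1)) = (indicator (all_plus P \<omega> X) y :: real)"
      proof (cases "\<forall>n\<in>X. \<omega> n y = 1")
        case True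
        then show ?thesis using y by (simp add: all_plus_def)
      next
        case False
        then show ?thesis using fin by (auto simp: all_plus_def prod_zero_iff)
      qed
      then show "(\<Prod>n\<in>X. a * of_bool (\<omega> n y = 1)) * (\<Prod>n\<in>A - X. b)
          = indicator (all_plus P \<omega> X) y * (a ^ card X * b ^ card (A - X))"
        by (simp only: prod.distrib prod_constant mult_ac)
    qed
    finally show ?thesis .
  qed
  have "expectation (\<lambda>y. \<Prod>n\<in>A. exp (h + \<beta> * \<omega> n y))
      = expectation (\<lambda>y. \<Sum>X\<in>Pow A. indicator (all_plus P \<omega> X) y * (a ^ card X * b ^ card (A - X)))"
    by (rule Bochner_Integration.integral_cong[OF refl expand])
  also have "\<dots> = (\<Sum>X\<in>Pow A. prob (all_plus P \<omega> X) * (a ^ card X * b ^ card (A - X)))"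
    by (subst Bochner_Integration.integral_sum)
       (auto intro!: integrable_mult_left integrable_real_indicator simp: less_top[symmetric])
  also have "\<dots> \<le> (\<Sum>X\<in>Pow A. C * s ^ card X * (a ^ card X * b ^ card (A - X)))"
  proof (intro sum_mono mult_right_mono)
    fix X assume "X \<in> Pow A"
    then have "prob (all_plus P \<omega> X) \<le> prob (all_plus P \<omega> {1..card X})"
      using A by (intro prob_all_plus_le_block[OF corr]) (auto intro: finite_subset)
    then show "prob (all_plus P \<omega> X) \<le> C * s ^ card X" using decay order_trans by blast
  qed (use a b in auto)
  also have "\<dots> = C * (\<Sum>X\<in>Pow A. (\<Prod>n\<in>X. a * s) * (\<Prod>n\<in>A - X. b))"
    by (simp add: sum_distrib_left power_mult_distrib mult_ac)
  also have "(\<Sum>X\<in>Pow A. (\<Prod>n\<in>X. a * s) * (\<Prod>n\<in>A - X. b)) = (\<Prod>n\<in>A. a * s + b)"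
    by (rule prod_add[OF A(1), symmetric])
  finally show ?thesis by (simp add: a_def b_def)
qed

lemma frequently_all_plus_ge:
  assumes "plus_stretch_rate P \<omega> = 0" and "0 < \<epsilon>"
  shows "\<exists>\<^sub>F n in sequentially. exp (- \<epsilon> * real n) \<le> prob (all_plus P \<omega> {1..n})"
proof (rule ccontr)
  assume "\<not> ?thesis"
  then have "\<forall>\<^sub>F n in sequentially. prob (all_plus P \<omega> {1..n}) < exp (- \<epsilon> * real n)"
    by (simp add: not_frequently not_le)
  then have "\<forall>\<^sub>F n in sequentially. ereal \<epsilon> \<le> ereal (- (1 / real n)) * log_prob (prob (all_plus P \<omega> {1..n}))"
    using eventually_gt_at_top[of 0]
  proof eventually_elim
    case (elim n)
    show ?case
    proof (cases "prob (all_plus P \<omega> {1..n}) = 0")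
      case True
      then show ?thesis using elim(2) by (simp add: log_prob_def)
    next
      case False
      then have "0 < prob (all_plus P \<omega> {1..n})" by (simp add: zero_less_measure_iff)
      then have "ln (prob (all_plus P \<omega> {1..n})) \<le> - \<epsilon> * real n"
        using elim(1) by (metis ln_exp ln_le_cancel_iff exp_gt_zero less_imp_le)
      then have "\<epsilon> \<le> - (1 / real n) * ln (prob (all_plus P \<omega> {1..n}))"
        using elim(2) by (simp add: field_simps)
      then show ?thesis using False by (simp add: log_prob_def)
    qed
  qed
  then have "ereal \<epsilon> \<le> plus_stretch_rate P \<omega>"
    unfolding plus_stretch_rate_def by (rule Liminf_bounded)
  then show False using assms by simp
qed

end

section \<open>The free energy of the pinning model\<close>

locale pinning = polynomial_renewal M \<tau> n0 c p + env: sign_environment P \<omega>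
  for M :: "'a measure" and \<tau> :: "nat \<Rightarrow> 'a \<Rightarrow> nat" and n0 :: nat and c p :: real
    and P :: "'b measure" and \<omega> :: "nat \<Rightarrow> 'b \<Rightarrow> real"
begin

text \<open>
  Values other than 1 are read as \<open>-1\<close>, which agrees with the charge on every environment path and keeps
  the field bounded on the whole sequence space.
\<close>

definition field :: "real \<Rightarrow> real \<Rightarrow> (nat \<Rightarrow> real) \<Rightarrow> nat \<Rightarrow> real" where
  "field \<beta> h w n = h + \<beta> * (if w n = 1 then 1 else - 1)"

abbreviation env_field :: "real \<Rightarrow> real \<Rightarrow> 'b \<Rightarrow> nat \<Rightarrow> real" where
  "env_field \<beta> h y \<equiv> field \<beta> h (\<lambda>i. \<omega> i y)"

abbreviation F :: "real \<Rightarrow> real \<Rightarrow> real" where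
  "F \<equiv> free_energy M \<tau> P \<omega>"

lemma field_bound: "\<bar>field \<beta> h w n\<bar> \<le> \<bar>h\<bar> + \<bar>\<beta>\<bar>"
  by (auto simp: field_def)

lemma field_ge: "- (\<bar>h\<bar> + \<bar>\<beta>\<bar>) \<le> field \<beta> h w n"
  using field_bound[of \<beta> h w n] by linarith

lemma env_field_eq: "y \<in> space P \<Longrightarrow> env_field \<beta> h y n = h + \<beta> * \<omega> n y"
  using env.env_values[of y n] by (auto simp: field_def)

lemma partition_function_eq:
  "y \<in> space P \<Longrightarrow> partition_function M \<tau> \<beta> h (\<lambda>i. \<omega> i y) N = free (env_field \<beta> h y) N"
  by (simp add: partition_function_def free_def weight_def[abs_def] env_field_eq)

lemma pinned_field_measurable: "(\<lambda>w. pinned (field \<beta> h w) n) \<in> borel_measurable env.law"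
proof (induction n rule: less_induct)
  case (less n)
  have [measurable]: "(\<lambda>w. w i) \<in> borel_measurable sequence_space" for i
    by (rule measurable_component_singleton) simp
  have field [measurable]: "(\<lambda>w. field \<beta> h w i) \<in> borel_measurable env.law" for i
    unfolding field_def by (simp add: measurable_distr_eq1)
  show ?case
  proof (cases n)
    case 0
    then show ?thesis by (simp add: pinned_0)
  next
    case (Suc m)
    show ?thesis unfolding Suc pinned_Suc
      using less.IH Suc
      by (intro borel_measurable_times borel_measurable_sum measurable_compose[OF field borel_measurable_exp]) auto
  qed
qed

text \<open>
  The logarithm of the pinned partition function is superadditive under the shift of the environment
  and grows at most linearly in absolute value, so the superadditive ergodic theorem applies to it.
\<close>

lemma free_energy_exists:
  obtains \<gamma> where "AE y in P. (\<lambda>N. ln (free (env_field \<beta> h y) N) / real N) \<longlonglongrightarrow> \<gamma>"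
proof -
  define X where "X n w = ln (pinned (field \<beta> h w) n)" for n w
  have "\<exists>\<gamma>. AE w in env.law. (\<lambda>n. X n w / real n) \<longlonglongrightarrow> \<gamma>"
  proof (rule env.law.superadditive_ergodic[of X n0 "\<bar>h\<bar> + \<bar>\<beta>\<bar> + \<bar>ln c\<bar> + p"])
    show "X n \<in> borel_measurable env.law" for n
      unfolding X_def using pinned_field_measurable by (rule borel_measurable_ln)
    show "\<bar>X n w\<bar> \<le> (\<bar>h\<bar> + \<bar>\<beta>\<bar> + \<bar>ln c\<bar> + p) * real n" if "n0 \<le> n" for n w
      unfolding X_def using that field_bound by (rule ln_pinned_bound)
    show "env.law.superadditive_from n0 X"
      unfolding env.law.superadditive_from_def
    proof (intro allI impI ballI)
      fix n m and w :: "nat \<Rightarrow> real" assume nm: "n0 \<le> n" "n0 \<le> m"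
      have shift: "field \<beta> h ((seq_shift ^^ n) w) = (\<lambda>k. field \<beta> h w (n + k))"
        by (simp add: fun_eq_iff field_def seq_shift_iterate add.commute)
      have pos: "0 < pinned (field \<beta> h w) n" "0 < pinned (\<lambda>k. field \<beta> h w (n + k)) m"
        using nm by (auto intro: pinned_pos)
      have "X n w + X m ((seq_shift ^^ n) w)
          = ln (pinned (field \<beta> h w) n * pinned (\<lambda>k. field \<beta> h w (n + k)) m)"
        unfolding X_def shift using pos by (simp add: ln_mult_pos)
      also have "\<dots> \<le> X (n + m) w"
        unfolding X_def using pos pinned_pos[of "n + m"] nm
        by (subst ln_le_cancel_iff) (auto intro: pinned_superadditive mult_pos_pos)
      finally show "X n w + X m ((seq_shift ^^ n) w) \<le> X (n + m) w" .
    qed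
    show "1 \<le> n0" by (rule n0_ge)
  qed blast
  then obtain \<gamma> where "AE w in env.law. (\<lambda>n. X n w / real n) \<longlonglongrightarrow> \<gamma>" by blast
  then have "AE y in P. (\<lambda>n. X n (\<lambda>i. \<omega> i y) / real n) \<longlonglongrightarrow> \<gamma>" by (rule env.AE_law)
  then have "AE y in P. (\<lambda>N. ln (free (env_field \<beta> h y) N) / real N) \<longlonglongrightarrow> \<gamma>"
    by (rule AE_mp) (auto simp: X_def intro!: AE_I2 ln_free_limit field_ge)
  then show thesis by (rule that)
qed

lemma free_energy_AE:
  "AE y in P. (\<lambda>N. ln (free (env_field \<beta> h y) N) / real N) \<longlonglongrightarrow> F \<beta> h"
proof -
  obtain \<gamma> where \<gamma>: "AE y in P. (\<lambda>N. ln (free (env_field \<beta> h y) N) / real N) \<longlonglongrightarrow> \<gamma>"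
    by (rule free_energy_exists)
  have rewrite: "(AE y in P. (\<lambda>N. 1 / real N * ln (partition_function M \<tau> \<beta> h (\<lambda>i. \<omega> i y) N)) \<longlonglongrightarrow> f)
      \<longleftrightarrow> (AE y in P. (\<lambda>N. ln (free (env_field \<beta> h y) N) / real N) \<longlonglongrightarrow> f)" for f
    by (rule AE_cong) (simp add: partition_function_eq)
  have "F \<beta> h = \<gamma>"
    unfolding free_energy_def rewrite
  proof (rule the_equality)
    show "AE y in P. (\<lambda>N. ln (free (env_field \<beta> h y) N) / real N) \<longlonglongrightarrow> \<gamma>" by fact
  next
    fix f assume "AE y in P. (\<lambda>N. ln (free (env_field \<beta> h y) N) / real N) \<longlonglongrightarrow> f"
    with \<gamma> have "AE y in P. f = \<gamma>"
      by eventually_elim (rule LIMSEQ_unique)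
    then show "f = \<gamma>" by (rule env.AE_witness)
  qed
  with \<gamma> show ?thesis by simp
qed

lemma free_energy_geI:
  assumes "AE y in P. \<forall>\<^sub>F N in sequentially. a * real N + d \<le> ln (free (env_field \<beta> h y) N)"
  shows "a \<le> F \<beta> h"
proof -
  obtain y where lim: "(\<lambda>N. ln (free (env_field \<beta> h y) N) / real N) \<longlonglongrightarrow> F \<beta> h"
    and ev: "\<forall>\<^sub>F N in sequentially. a * real N + d \<le> ln (free (env_field \<beta> h y) N)"
    using env.AE_witness[OF AE_conjI[OF free_energy_AE assms]] by blast
  have "(\<lambda>N. a + d / real N) \<longlonglongrightarrow> a" by real_asymp
  then show ?thesis
  proof (rule tendsto_le[OF trivial_limit_sequentially lim])
    show "\<forall>\<^sub>F N in sequentially. a + d / real N \<le> ln (free (env_field \<beta> h y) N) / real N"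
      using ev eventually_gt_at_top[of 0]
    proof eventually_elim
      case (elim N)
      have "(a * real N + d) / real N \<le> ln (free (env_field \<beta> h y) N) / real N"
        using elim(1) by (rule divide_right_mono) simp
      then show ?case using elim(2) by (simp add: add_divide_distrib)
    qed
  qed
qed

lemma free_energy_leI:
  assumes "AE y in P. \<forall>\<^sub>F N in sequentially. ln (free (env_field \<beta> h y) N) \<le> a * real N"
  shows "F \<beta> h \<le> a"
proof -
  obtain y where lim: "(\<lambda>N. ln (free (env_field \<beta> h y) N) / real N) \<longlonglongrightarrow> F \<beta> h"
    and ev: "\<forall>\<^sub>F N in sequentially. ln (free (env_field \<beta> h y) N) \<le> a * real N"
    using env.AE_witness[OF AE_conjI[OF free_energy_AE assms]] by blast
  show ?thesis
  proof (rule tendsto_upperbound[OF lim _ trivial_limit_sequentially])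
    show "\<forall>\<^sub>F N in sequentially. ln (free (env_field \<beta> h y) N) / real N \<le> a"
      using ev eventually_gt_at_top[of 0] by eventually_elim (simp add: field_simps)
  qed
qed

lemma free_energy_lipschitz:
  assumes "h \<le> h'"
  shows "F \<beta> h \<le> F \<beta> h'" and "F \<beta> h' \<le> F \<beta> h + (h' - h)"
proof -
  obtain y where lim: "(\<lambda>N. ln (free (env_field \<beta> h y) N) / real N) \<longlonglongrightarrow> F \<beta> h"
    and lim': "(\<lambda>N. ln (free (env_field \<beta> h' y) N) / real N) \<longlonglongrightarrow> F \<beta> h'"
    using env.AE_witness[OF AE_conjI[OF free_energy_AE free_energy_AE]] by blast
  have shift: "env_field \<beta> h' y = (\<lambda>n. env_field \<beta> h y n + (h' - h))"
    by (simp add: field_def fun_eq_iff)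
  have le: "ln (free (env_field \<beta> h y) N) \<le> ln (free (env_field \<beta> h' y) N)" for N
    using assms by (subst ln_le_cancel_iff) (auto simp: free_pos shift intro!: free_mono)
  show "F \<beta> h \<le> F \<beta> h'"
    by (rule LIMSEQ_le[OF lim lim']) (use le in \<open>auto intro!: divide_right_mono\<close>)
  have ge: "ln (free (env_field \<beta> h' y) N) \<le> ln (free (env_field \<beta> h y) N) + (h' - h) * real N" for N
  proof -
    have "ln (free (env_field \<beta> h' y) N) \<le> ln (exp ((h' - h) * real N) * free (env_field \<beta> h y) N)"
      using free_shift_le[of "h' - h" "env_field \<beta> h y" N] assms
      by (subst ln_le_cancel_iff) (auto simp: free_pos shift)
    then show ?thesis by (simp add: ln_mult_pos free_pos)
  qed
  have "(\<lambda>N. ln (free (env_field \<beta> h y) N) / real N + (h' - h)) \<longlonglongrightarrow> F \<beta> h + (h' - h)"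
    using lim by (intro tendsto_intros)
  then show "F \<beta> h' \<le> F \<beta> h + (h' - h)"
  proof (rule tendsto_le[OF trivial_limit_sequentially _ lim'])
    show "\<forall>\<^sub>F N in sequentially. ln (free (env_field \<beta> h' y) N) / real N
        \<le> ln (free (env_field \<beta> h y) N) / real N + (h' - h)"
      using eventually_gt_at_top[of 0]
    proof eventually_elim
      case (elim N)
      then show ?case using ge[of N] by (simp add: field_simps)
    qed
  qed
qed

lemma free_energy_nonneg: "0 \<le> F \<beta> h"
proof -
  obtain y where lim: "(\<lambda>N. ln (free (env_field \<beta> h y) N) / real N) \<longlonglongrightarrow> F \<beta> h"
    using env.AE_witness[OF free_energy_AE] by blast
  have "(\<lambda>N. ln (c * real (Suc N) powr (- p)) / real N) \<longlonglongrightarrow> 0"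
    using c_pos p_pos by real_asymp
  then show ?thesis
  proof (rule tendsto_le[OF trivial_limit_sequentially lim])
    show "\<forall>\<^sub>F N in sequentially. ln (c * real (Suc N) powr (- p)) / real N
        \<le> ln (free (env_field \<beta> h y) N) / real N"
      using eventually_ge_at_top[of n0]
    proof eventually_elim
      case (elim N)
      have "c * real (Suc N) powr (- p) \<le> free (env_field \<beta> h y) N"
        using K_ge[of "Suc N"] K_le_free[of N] elim order_trans by fastforce
      then show ?case
        using c_pos free_pos by (intro divide_right_mono) (auto simp: ln_le_cancel_iff)
    qed
  qed
qed

lemma free_energy_eq_0:
  assumes "0 \<le> \<beta>" and "h \<le> - \<beta>"
  shows "F \<beta> h = 0"
proof (rule antisym[OF free_energy_leI free_energy_nonneg], rule AE_I2, rule always_eventually, rule allI)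
  fix y N
  have "env_field \<beta> h y n \<le> 0" for n using assms by (auto simp: field_def)
  then have "free (env_field \<beta> h y) N \<le> 1" by (rule free_le_1)
  then show "ln (free (env_field \<beta> h y) N) \<le> 0 * real N"
    using free_pos by (simp add: ln_le_zero_iff)
qed

lemma free_energy_pos_large_field:
  assumes "0 \<le> \<beta>" and "\<beta> < h"
  shows "0 < F \<beta> h"
proof -
  obtain R c0 where R: "0 < R" "0 < c0" "\<And>l. n0 \<le> l \<Longrightarrow> c0 * exp (R * real l) \<le> pinned (\<lambda>_. h - \<beta>) l"
    using homogeneous_growth[of "h - \<beta>"] assms by auto
  have "R \<le> F \<beta> h"
  proof (rule free_energy_geI[where d = "ln c0"], rule AE_I2)
    fix y
    show "\<forall>\<^sub>F N in sequentially. R * real N + ln c0 \<le> ln (free (env_field \<beta> h y) N)"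
      using eventually_ge_at_top[of n0]
    proof eventually_elim
      case (elim N)
      have "c0 * exp (R * real N) \<le> pinned (\<lambda>_. h - \<beta>) N" by (rule R(3)[OF elim])
      also have "\<dots> \<le> free (\<lambda>_. h - \<beta>) N" by (rule pinned_le_free)
      also have "\<dots> \<le> free (env_field \<beta> h y) N"
        using assms by (intro free_mono) (auto simp: field_def)
      finally have "ln (c0 * exp (R * real N)) \<le> ln (free (env_field \<beta> h y) N)"
        using R(2) free_pos by (subst ln_le_cancel_iff) auto
      then show ?case using R(2) by (simp add: ln_mult_pos)
    qed
  qed
  with R(1) show ?thesis by linarith
qed

lemma critical_point_eqI:
  assumes "\<And>h. 0 < F \<beta> h \<longleftrightarrow> h_c < h"
  shows "critical_point M \<tau> P \<omega> \<beta> = h_c"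
  unfolding critical_point_def
proof (rule the_equality)
  show "\<forall>h. 0 < F \<beta> h \<longleftrightarrow> h_c < h" using assms by blast
  fix h' assume "\<forall>h. 0 < F \<beta> h \<longleftrightarrow> h' < h"
  then have "h' < h \<longleftrightarrow> h_c < h" for h using assms by blast
  then show "h' = h_c" by (metis less_irrefl linorder_neqE_linordered_idom)
qed

text \<open>
  The fields with positive free energy form an up-set by monotonicity, which is bounded below and
  nonempty; by the Lipschitz bound it is open, hence the open half-line above its infimum.
\<close>

lemma critical_point_ge:
  assumes "0 \<le> \<beta>" and zero: "F \<beta> h = 0"
  shows "h \<le> critical_point M \<tau> P \<omega> \<beta>"
proof -
  define S where "S = {h. 0 < F \<beta> h}"
  have lower: "h < x" if "x \<in> S" for x
    using free_energy_lipschitz(1)[of x h \<beta>] that zero by (force simp: S_def)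
  have ne: "S \<noteq> {}" using free_energy_pos_large_field[OF assms(1), of "\<beta> + 1"] by (auto simp: S_def)
  have bdd: "bdd_below S" using lower by (auto simp: bdd_below_def intro: less_imp_le)
  have "critical_point M \<tau> P \<omega> \<beta> = Inf S"
  proof (rule critical_point_eqI)
    fix x
    show "0 < F \<beta> x \<longleftrightarrow> Inf S < x"
    proof
      assume pos: "0 < F \<beta> x"
      have "F \<beta> x \<le> F \<beta> (x - F \<beta> x / 2) + F \<beta> x / 2"
        using free_energy_lipschitz(2)[of "x - F \<beta> x / 2" x \<beta>] pos by simp
      then have "x - F \<beta> x / 2 \<in> S" using pos by (simp add: S_def)
      then have "Inf S \<le> x - F \<beta> x / 2" using bdd by (rule cInf_lower)
      then show "Inf S < x" using pos by linarith
    next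
      assume "Inf S < x"
      then obtain z where "z \<in> S" "z < x" using cInf_less_iff[OF ne bdd] by blast
      then show "0 < F \<beta> x" using free_energy_lipschitz(1)[of z x \<beta>] by (auto simp: S_def)
    qed
  qed
  moreover have "h \<le> Inf S" using ne lower by (intro cInf_greatest) (auto intro: less_imp_le)
  ultimately show ?thesis by simp
qed

section \<open>Exponentially rare plus stretches\<close>

text \<open>
  With \<open>h = - \<beta> - ln q\<close> the annealed bound per contact is exactly 1, so the mean of the partition function
  is at most \<open>C\<close> for all \<open>N\<close>. Markov's inequality and the Borel-Cantelli lemma then exclude any
  exponential growth along almost every environment.
\<close>

lemma free_energy_zero_of_decay:
  assumes corr: "nonincreasing_correlations P \<omega>"
    and decay: "\<And>n. env.prob (all_plus P \<omega> {1..n}) \<le> C * s ^ n"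
    and "0 < s" "s < 1" "0 < \<beta>"
  shows "\<exists>h > - \<beta>. F \<beta> h = 0"
proof -
  define q where "q = (1 - exp (- 2 * \<beta>)) * s + exp (- 2 * \<beta>)"
  have e: "0 < exp (- 2 * \<beta>)" "exp (- 2 * \<beta>) < 1" using \<open>0 < \<beta>\<close> by auto
  have "(1 - exp (- 2 * \<beta>)) * s < (1 - exp (- 2 * \<beta>)) * 1"
    using e \<open>s < 1\<close> by (intro mult_strict_left_mono) auto
  then have "(1 - exp (- 2 * \<beta>)) * s < 1 - exp (- 2 * \<beta>)" by (simp only: mult_1_right)
  then have "q < 1" unfolding q_def by (simp only: less_diff_eq)
  moreover have "0 < q" unfolding q_def using e \<open>0 < s\<close> by (intro add_pos_pos mult_pos_pos) auto
  ultimately have q: "0 < q" "q < 1" by auto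
  define h where "h = - \<beta> - ln q"
  have h: "- \<beta> < h" using q by (simp add: h_def)
  have one: "(exp (h + \<beta>) - exp (h - \<beta>)) * s + exp (h - \<beta>) = 1"
  proof -
    have "exp (h - \<beta>) = exp (h + \<beta>) * exp (- 2 * \<beta>)" by (simp add: exp_add[symmetric])
    then have "(exp (h + \<beta>) - exp (h - \<beta>)) * s + exp (h - \<beta>) = exp (h + \<beta>) * q"
      by (simp add: q_def algebra_simps)
    also have "\<dots> = 1" using q by (simp add: h_def exp_minus)
    finally show ?thesis .
  qed
  define Z where "Z N y = (\<Sum>A\<in>Pow {1..N}. contact_set_prob N A * (\<Prod>n\<in>A. exp (h + \<beta> * \<omega> n y)))" for N y
  have Z: "free (env_field \<beta> h y) N = Z N y" if "y \<in> space P" for y N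
    unfolding free_eq_sum_contact_sets Z_def using that by (simp add: env_field_eq)
  have int: "integrable P (\<lambda>y. \<Prod>n\<in>A. exp (h + \<beta> * \<omega> n y))" if "finite A" for A
  proof (rule env.integrable_const_bound[of _ "\<Prod>n\<in>A. exp (h + \<beta>)"])
    show "AE y in P. norm (\<Prod>n\<in>A. exp (h + \<beta> * \<omega> n y)) \<le> (\<Prod>n\<in>A. exp (h + \<beta>))"
    proof (rule AE_I2)
      fix y assume y: "y \<in> space P"
      have "\<beta> * \<omega> n y \<le> \<beta>" for n using env.env_values[OF y, of n] \<open>0 < \<beta>\<close> by auto
      then have "(\<Prod>n\<in>A. exp (h + \<beta> * \<omega> n y)) \<le> (\<Prod>n\<in>A. exp (h + \<beta>))"
        by (intro prod_mono) auto
      then show "norm (\<Prod>n\<in>A. exp (h + \<beta> * \<omega> n y)) \<le> (\<Prod>n\<in>A. exp (h + \<beta>))"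
        by (simp add: prod_nonneg abs_of_nonneg)
    qed
  qed simp
  have Z_int: "integrable P (Z N)" for N
    unfolding Z_def by (intro Bochner_Integration.integrable_sum integrable_mult_right int) (auto intro: finite_subset)
  have Z_mean: "env.expectation (Z N) \<le> C" for N
  proof -
    have "env.expectation (Z N) = (\<Sum>A\<in>Pow {1..N}. env.expectation
        (\<lambda>y. contact_set_prob N A * (\<Prod>n\<in>A. exp (h + \<beta> * \<omega> n y))))"
      unfolding Z_def
      by (rule Bochner_Integration.integral_sum) (intro integrable_mult_right int, auto intro: finite_subset)
    also have "\<dots> \<le> (\<Sum>A\<in>Pow {1..N}. contact_set_prob N A * C)"
    proof (rule sum_mono)
      fix A assume "A \<in> Pow {1..N}"
      then have A: "finite A" "A \<subseteq> {1..}" by (auto intro: finite_subset)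
      have "env.expectation (\<lambda>y. \<Prod>n\<in>A. exp (h + \<beta> * \<omega> n y))
          \<le> C * ((exp (h + \<beta>) - exp (h - \<beta>)) * s + exp (h - \<beta>)) ^ card A"
        using \<open>0 < s\<close> \<open>0 < \<beta>\<close> A by (intro env.expectation_boltzmann_le[OF corr decay]) auto
      then have "env.expectation (\<lambda>y. \<Prod>n\<in>A. exp (h + \<beta> * \<omega> n y)) \<le> C"
        unfolding one by simp
      then show "env.expectation (\<lambda>y. contact_set_prob N A * (\<Prod>n\<in>A. exp (h + \<beta> * \<omega> n y)))
          \<le> contact_set_prob N A * C"
        by (simp add: mult_left_mono contact_set_prob_nonneg)
    qed
    also have "\<dots> = C" using sum_contact_set_prob[of N] by (simp add: sum_distrib_right[symmetric])
    finally show ?thesis .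
  qed
  have "F \<beta> h \<le> 0 + \<epsilon>" if "0 < \<epsilon>" for \<epsilon>
  proof -
    define B where "B N = {y \<in> space P. exp (\<epsilon> * real N) \<le> Z N y}" for N
    have B_sets: "B N \<in> sets P" for N
      unfolding B_def using borel_measurable_integrable[OF Z_int] by measurable
    have B_prob: "measure P (B N) \<le> C * exp (- \<epsilon>) ^ N" for N
    proof -
      have "measure P (B N) \<le> env.expectation (Z N) / exp (\<epsilon> * real N)"
        unfolding B_def
      proof (rule integral_Markov_inequality_measure[OF Z_int, of "{}"])
        show "AE y in P. 0 \<le> Z N y"
          by (rule AE_I2) (auto simp: Z_def intro!: sum_nonneg mult_nonneg_nonneg prod_nonneg contact_set_prob_nonneg)
      qed auto
      also have "\<dots> \<le> C / exp (\<epsilon> * real N)"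
        by (intro divide_right_mono Z_mean) simp
      also have "\<dots> = C * exp (- \<epsilon>) ^ N"
        by (simp add: exp_minus exp_of_nat2_mult field_simps)
      finally show ?thesis .
    qed
    have "summable (\<lambda>N. C * exp (- \<epsilon>) ^ N)"
      using that by (intro summable_mult summable_geometric) simp
    then have "summable (\<lambda>N. measure P (B N))"
      by (rule summable_comparison_test'[where N = 0]) (use B_prob in simp)
    then have "AE y in P. \<forall>\<^sub>F N in sequentially. y \<in> space P - B N"
      using B_sets by (intro borel_cantelli_AE1) (auto simp: less_top[symmetric])
    then have "AE y in P. \<forall>\<^sub>F N in sequentially. ln (free (env_field \<beta> h y) N) \<le> \<epsilon> * real N"
    proof (rule AE_mp, intro AE_I2 impI)
      fix y assume y: "y \<in> space P" and ev: "\<forall>\<^sub>F N in sequentially. y \<in> space P - B N"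
      show "\<forall>\<^sub>F N in sequentially. ln (free (env_field \<beta> h y) N) \<le> \<epsilon> * real N"
        using ev
      proof eventually_elim
        case (elim N)
        then have "free (env_field \<beta> h y) N \<le> exp (\<epsilon> * real N)" using y by (simp add: B_def Z)
        then show ?case using free_pos by (metis ln_exp ln_le_cancel_iff exp_gt_zero)
      qed
    qed
    then show ?thesis using free_energy_leI by simp
  qed
  then have "F \<beta> h \<le> 0" by (rule field_le_epsilon)
  then have "F \<beta> h = 0" using free_energy_nonneg[of \<beta> h] by linarith
  with h show ?thesis by blast
qed

section \<open>Subexponentially rare plus stretches\<close>

text \<open>
  Three constants are balanced. A stretch gains \<open>exp (R * l)\<close>. At \<open>\<epsilon> = R / (4 * p)\<close>, the bound
  \<open>q \<ge> exp (- \<epsilon> * l)\<close> makes the price of a jump of length of order \<open>1 / q\<close> at most \<open>exp (R * l / 4)\<close> up to a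
  constant, and \<open>\<kappa> = R / 4\<close> reserves another \<open>exp (R * l / 4)\<close>; the remaining \<open>exp (R * l / 2)\<close> absorbs the
  constants, collected in \<open>E\<close>, once \<open>l\<close> is large. The choice of \<open>D\<close> makes the linear part of the jump
  prices equal to \<open>\<kappa> * q / 2\<close> per unit length, less than the gain \<open>\<kappa> * (3 * q / 4)\<close> that
  the frequency of stretches guarantees.
\<close>

lemma free_energy_pos_of_subexponential:
  assumes rate: "plus_stretch_rate P \<omega> = 0" and "- \<beta> < h"
  shows "0 < F \<beta> h"
proof -
  define b where "b = \<bar>h\<bar> + \<bar>\<beta>\<bar>"
  obtain R c0 where R: "0 < R" "0 < c0" "\<And>l. n0 \<le> l \<Longrightarrow> c0 * exp (R * real l) \<le> pinned (\<lambda>_. h + \<beta>) l"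
    using homogeneous_growth[of "h + \<beta>"] assms(2) by auto
  define \<kappa> where "\<kappa> = R / 4"
  define E where "E = exp (- b) * c * (\<kappa> / (2 * p)) powr p * c0 * exp (- \<kappa> * real n0)"
  have \<kappa>: "0 < \<kappa>" and E: "0 < E" using R c_pos p_pos by (auto simp: \<kappa>_def E_def)
  have "\<exists>\<^sub>F l in sequentially. exp (- (R / (4 * p)) * real l) \<le> env.prob (all_plus P \<omega> {1..l})"
    using R p_pos by (intro env.frequently_all_plus_ge[OF rate]) simp
  moreover have "\<forall>\<^sub>F l in sequentially. 1 \<le> E * exp (R / 2 * real l)"
  proof -
    have "filterlim (\<lambda>l. E * exp (R / 2 * real l)) at_top sequentially"
      using E R(1) by real_asymp
    then show ?thesis by (simp add: filterlim_at_top)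
  qed
  ultimately have "\<exists>\<^sub>F l in sequentially. exp (- (R / (4 * p)) * real l) \<le> env.prob (all_plus P \<omega> {1..l})
      \<and> (1 \<le> E * exp (R / 2 * real l) \<and> n0 \<le> l)"
    by (intro frequently_eventually_frequently eventually_conj eventually_ge_at_top)
  then obtain l where l: "exp (- (R / (4 * p)) * real l) \<le> env.prob (all_plus P \<omega> {1..l})"
      "1 \<le> E * exp (R / 2 * real l)" "n0 \<le> l"
    using frequently_ex by blast
  define q where "q = env.prob (all_plus P \<omega> {1..l})"
  have q: "0 < q" using l(1) exp_gt_zero less_le_trans unfolding q_def by blast
  define D where "D = 2 * p / (\<kappa> * q)"
  have D: "0 < D" using p_pos \<kappa> q by (simp add: D_def)
  have pD: "p / D = \<kappa> * q / 2" using p_pos \<kappa> q by (simp add: D_def)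
  define V where "V = c0 * exp (R * real l)"
  have key: "exp (\<kappa> * real (n0 + l)) \<le> exp (- b) * c * D powr (- p) * V"
  proof -
    have "inverse D = \<kappa> / (2 * p) * q"
      using p_pos \<kappa> q by (simp add: D_def field_simps)
    then have "D powr (- p) = (\<kappa> / (2 * p) * q) powr p"
      using inverse_powr[of D p] by (simp only: powr_minus)
    also have "\<dots> = (\<kappa> / (2 * p)) powr p * q powr p"
      by (rule powr_mult)
    finally have D_powr: "D powr (- p) = (\<kappa> / (2 * p)) powr p * q powr p" .
    have "exp (- (R / 4) * real l) = exp (- (R / (4 * p)) * real l) powr p"
      using p_pos by (simp add: powr_def)
    also have "\<dots> \<le> q powr p"
      using l(1) p_pos by (intro powr_mono2) (auto simp: q_def)
    finally have q_powr: "exp (- (R / 4) * real l) \<le> q powr p" .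
    have "exp (\<kappa> * real (n0 + l)) \<le> exp (\<kappa> * real (n0 + l)) * (E * exp (R / 2 * real l))"
      using l(2) by simp
    also have "\<dots> = exp (- b) * c * (\<kappa> / (2 * p)) powr p * c0 *
        (exp (\<kappa> * real (n0 + l)) * exp (- \<kappa> * real n0) * exp (R / 2 * real l))"
      by (simp add: E_def mult_ac)
    also have "exp (\<kappa> * real (n0 + l)) * exp (- \<kappa> * real n0) * exp (R / 2 * real l)
        = exp (- (R / 4) * real l) * exp (R * real l)"
      by (simp add: mult_exp_exp \<kappa>_def field_simps)
    also have "exp (- b) * c * (\<kappa> / (2 * p)) powr p * c0 * (exp (- (R / 4) * real l) * exp (R * real l))
        \<le> exp (- b) * c * (\<kappa> / (2 * p)) powr p * c0 * (q powr p * exp (R * real l))"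
      using q_powr c_pos R(2) by (intro mult_left_mono mult_right_mono) auto
    also have "\<dots> = exp (- b) * c * D powr (- p) * V"
      by (simp add: D_powr V_def mult_ac)
    finally show ?thesis .
  qed
  define A where "A = exp (- b) * c * D powr (- p) * exp (- \<kappa> * real (2 * n0 + l))"
  have A: "0 < A" using c_pos D by (simp add: A_def)
  have "AE w in env.law. \<forall>\<^sub>F N in sequentially. (q - q / 4) * real N
      \<le> (\<Sum>k<N. indicator (env.plus_on {1..l}) ((seq_shift ^^ k) w))"
    using env.law.visit_frequency_ge[OF env.plus_on_sets, of "q / 4" "{1..l}"] q
    by (simp add: q_def env.prob_all_plus)
  then have freq: "AE y in P. \<forall>\<^sub>F N in sequentially. (q - q / 4) * real N
      \<le> (\<Sum>k<N. indicator (env.plus_on {1..l}) ((seq_shift ^^ k) (\<lambda>i. \<omega> i y)))"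
    by (rule env.AE_law)
  have "\<kappa> * q / 4 \<le> F \<beta> h"
  proof (rule free_energy_geI[where d = "ln A"], rule AE_mp[OF freq], intro AE_I2 impI)
    fix y assume ev: "\<forall>\<^sub>F N in sequentially. (q - q / 4) * real N
      \<le> (\<Sum>k<N. indicator (env.plus_on {1..l}) ((seq_shift ^^ k) (\<lambda>i. \<omega> i y)))"
    define G where "G k \<longleftrightarrow> (\<forall>i\<in>{1..l}. \<omega> (i + k) y = 1)" for k
    have G_eq: "indicator (env.plus_on {1..l}) ((seq_shift ^^ k) (\<lambda>i. \<omega> i y)) = (of_bool (G k) :: real)" for k
      by (simp add: G_def env.plus_on_def seq_shift_iterate indicator_def)
    have good: "V \<le> pinned (\<lambda>i. env_field \<beta> h y (k + i)) l" if "G k" for k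
    proof -
      have "pinned (\<lambda>i. env_field \<beta> h y (k + i)) l = pinned (\<lambda>_. h + \<beta>) l"
        using that by (intro pinned_cong) (simp add: G_def field_def add.commute)
      then show ?thesis using R(3)[OF l(3)] by (simp add: V_def)
    qed
    have b_le: "- b \<le> env_field \<beta> h y n" for n
      unfolding b_def by (rule field_ge)
    show "\<forall>\<^sub>F N in sequentially. \<kappa> * q / 4 * real N + ln A \<le> ln (free (env_field \<beta> h y) N)"
      using ev eventually_ge_at_top[of n0]
    proof eventually_elim
      case (elim N)
      define S where "S = (\<Sum>k<N. of_bool (G k) :: real)"
      have "(q - q / 4) * real N \<le> S" using elim(1) unfolding G_eq S_def .
      then have "\<kappa> * ((q - q / 4) * real N) \<le> \<kappa> * S" using \<kappa> by (intro mult_left_mono) auto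
      then have slope: "\<kappa> * q / 4 * real N \<le> \<kappa> * S - p / D * real N"
        unfolding pD by (simp add: algebra_simps)
      have "A * exp (\<kappa> * S - p / D * real N) \<le> pinned (env_field \<beta> h y) N"
        unfolding A_def S_def
        by (rule pinned_lower_bound_by_good_stretches[OF D less_imp_le[OF \<kappa>] key b_le good elim(2)])
      also have "\<dots> \<le> free (env_field \<beta> h y) N" by (rule pinned_le_free)
      finally have "ln (A * exp (\<kappa> * S - p / D * real N)) \<le> ln (free (env_field \<beta> h y) N)"
        using A free_pos by (subst ln_le_cancel_iff) auto
      moreover have "ln (A * exp (\<kappa> * S - p / D * real N)) = ln A + (\<kappa> * S - p / D * real N)"
        using A by (simp add: ln_mult_pos)
      ultimately show ?case using slope by linarith
    qed
  qed
  moreover have "0 < \<kappa> * q / 4" using \<kappa> q by simp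
  ultimately show ?thesis by linarith
qed

section \<open>The critical point\<close>

theorem critical_point_dichotomy:
  assumes corr: "nonincreasing_correlations P \<omega>"
  shows "((\<forall>\<beta>>0. critical_point M \<tau> P \<omega> \<beta> = - \<beta>) \<longleftrightarrow> plus_stretch_rate P \<omega> = 0) \<and>
         (plus_stretch_rate P \<omega> > 0 \<longrightarrow> (\<forall>\<beta>>0. critical_point M \<tau> P \<omega> \<beta> > - \<beta>))"
proof -
  have trivial: "critical_point M \<tau> P \<omega> \<beta> = - \<beta>" if "plus_stretch_rate P \<omega> = 0" "0 < \<beta>" for \<beta>
  proof (rule critical_point_eqI)
    fix h
    show "0 < F \<beta> h \<longleftrightarrow> - \<beta> < h"
      using free_energy_pos_of_subexponential[OF that(1), of \<beta> h] free_energy_eq_0[of \<beta> h] that(2)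
      by (cases "- \<beta> < h") auto
  qed
  have strict: "- \<beta> < critical_point M \<tau> P \<omega> \<beta>" if rate: "0 < plus_stretch_rate P \<omega>" and "0 < \<beta>" for \<beta>
  proof -
    obtain s C where "0 < s" "s < 1" "\<And>n. env.prob (all_plus P \<omega> {1..n}) \<le> C * s ^ n"
      using env.all_plus_exponential_decay[OF rate] by blast
    then obtain h where "- \<beta> < h" "F \<beta> h = 0"
      using free_energy_zero_of_decay[OF corr, of C s \<beta>] \<open>0 < \<beta>\<close> by blast
    then show ?thesis using critical_point_ge[of \<beta> h] \<open>0 < \<beta>\<close> by linarith
  qed
  show ?thesis
    using trivial strict env.plus_stretch_rate_nonneg
    by (metis less_irrefl order_le_less zero_less_one)
qed

end

lemma polynomial_renewalI:
  assumes "renewal_process M \<tau>" and "\<alpha> > 0" and "c > 0"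
    and equiv: "asymp_equiv (inter_arrival M \<tau>) sequentially (\<lambda>n. c * real n powr (- (1 + \<alpha>)))"
  obtains n0 where "polynomial_renewal M \<tau> n0 (c / 2) (1 + \<alpha>)"
proof -
  interpret renewal_process M \<tau> by fact
  have "((\<lambda>n. if K n = 0 \<and> c * real n powr (- (1 + \<alpha>)) = 0 then 1 else K n / (c * real n powr (- (1 + \<alpha>)))) \<longlongrightarrow> 1) sequentially"
    using equiv unfolding asymp_equiv_def .
  then have "\<forall>\<^sub>F n in sequentially. 1 / 2 < (if K n = 0 \<and> c * real n powr (- (1 + \<alpha>)) = 0 then 1 else K n / (c * real n powr (- (1 + \<alpha>))))"
    by (rule order_tendstoD(1)) simp
  then have "\<forall>\<^sub>F n in sequentially. 1 \<le> n \<and> c / 2 * real n powr (- (1 + \<alpha>)) \<le> K n"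
    using eventually_ge_at_top[of 1]
  proof eventually_elim
    case (elim n)
    have "0 < c * real n powr (- (1 + \<alpha>))" using elim(2) \<open>c > 0\<close> by simp
    then show ?case using elim by (auto simp: field_simps split: if_splits)
  qed
  then obtain n0 where n0: "\<And>n. n0 \<le> n \<Longrightarrow> 1 \<le> n \<and> c / 2 * real n powr (- (1 + \<alpha>)) \<le> K n"
    unfolding eventually_sequentially by blast
  have "polynomial_renewal M \<tau> n0 (c / 2) (1 + \<alpha>)"
    by unfold_locales (use n0 \<open>\<alpha> > 0\<close> \<open>c > 0\<close> in auto)
  then show thesis by (rule that)
qed

theorem theorem2p3:
  fixes M :: "'a measure" and \<tau> :: "nat \<Rightarrow> 'a \<Rightarrow> nat"
    and P :: "'b measure" and \<omega> :: "nat \<Rightarrow> 'b \<Rightarrow> real"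
    and \<alpha> c\<^sub>K :: real
  assumes "renewal_process M \<tau>"
    and "\<alpha> > 0" and "\<alpha> \<noteq> 1" and "c\<^sub>K > 0"
    and "asymp_equiv (inter_arrival M \<tau>) sequentially (\<lambda>n. c\<^sub>K * real n powr (- (1 + \<alpha>)))"
    and "sign_environment P \<omega>"
    and "nonincreasing_correlations P \<omega>"
  shows "((\<forall>\<beta>>0. critical_point M \<tau> P \<omega> \<beta> = - \<beta>) \<longleftrightarrow> plus_stretch_rate P \<omega> = 0) \<and>
         (plus_stretch_rate P \<omega> > 0 \<longrightarrow> (\<forall>\<beta>>0. critical_point M \<tau> P \<omega> \<beta> > - \<beta>))"
proof -
  obtain n0 where "polynomial_renewal M \<tau> n0 (c\<^sub>K / 2) (1 + \<alpha>)"
    using polynomial_renewalI[OF assms(1,2,4,5)] .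
  then have "pinning M \<tau> n0 (c\<^sub>K / 2) (1 + \<alpha>) P \<omega>"
    using assms(6) by (simp add: pinning_def)
  then show ?thesis
    using assms(7) by (rule pinning.critical_point_dichotomy)
qed

end
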